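(* There is a quantum query algorithm that, for every integer $n$, all integers $1\le h,w\le n$, and every function $f:\{0,\dots,n-1\}\times\{0,\dots,n-1\}\to\{0,1\}$ whose empty areas are rectangles, solves the problem $LREC2(f,n,h,w)$ (find an empty rectangle of the largest area among those of height at least $h$ and width at least $w$) with query complexity $O(n^{1.5}\cdot T_f)$ and error probability $0.1$, where $T_f$ is the query complexity of computing $f$.
   Context: Given $f:\{0,\dots,n-1\}^2\to\{0,1\}$, a quadruple $(x_1,y_1,x_2,y_2)$ with $0\le x_1\le x_2\le n-1$ and $0\le y_1\le y_2\le n-1$ is an empty rectangle if $f(i,j)=0$ for all $x_1\le i\le x_2$, $y_1\le j\le y_2$. Its width is $x_2-x_1+1$, its height is $y_2-y_1+1$, and its size (area) is $(x_2-x_1+1)(y_2-y_1+1)$. The empty areas of $f$ are rectangles if for every $(i,j)$: $f(i,j)=0$ iff there is an empty rectangle $(x_1,y_1,x_2,y_2)$ with $x_1\le i\le x_2$, $y_1\le j\le y_2$ such that (1) $x_1=0$ or $f(x_1-1,j')=1$ for all $y_1\le j'\le y_2$; (2) $x_2=n-1$ or $f(x_2+1,j')=1$ for all $y_1\le j'\le y_2$; (3) $y_1=0$ or $f(i',y_1-1)=1$ for all $x_1\le i'\le x_2$; (4) $y_2=n-1$ or $f(i',y_2+1)=1$ for all $x_1\le i'\le x_2$. Problem $LREC2(f,n,h,w)$ (Largest Empty Rectangle for Rectangle Empty Areas): under the promise that the empty areas of $f$ are rectangles, output an empty rectangle of height at least $h$ and width at least $w$ whose size is largest among all such empty rectangles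 (if there is none, output $(NULL,NULL,NULL,NULL)$). The integers $h,w$ are known to the algorithm. Quantum query model: the input is accessed through the unitary $|i\rangle|z\rangle|w\rangle\mapsto|i\rangle|z+x_i \bmod 2\rangle|w\rangle$, where $x_i$ is the input value with index $i$. An algorithm alternates input-independent unitaries with applications of the query unitary and ends with a measurement; its query complexity is the number of applications of the query unitary. The error probability is the maximum over inputs satisfying the promise of the probability that the output is not correct (error probability $0.1$ means at most $0.1$). $T_f$ denotes the query complexity of computing $f$: the number of queries used for one (coherent) evaluation $(i,j)\mapsto f(i,j)$; $T_f=1$ if $f$ itself is the queried input. *)

theory Defs
  imports Complex_Main "Jordan_Normal_Form.Schur_Decomposition"
begin

section \<open>Largest empty rectangle\<close>

text \<open>A grid function is a function on \<open>{0,...,n-1}\<^sup>2\<close> with \<open>True\<close> for 1 and \<open>False\<close> for 0; its values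
  outside the grid are irrelevant. Rectangles are quadruples \<open>(x1, y1, x2, y2)\<close> of inclusive
  bounds; \<open>x\<close> (width) is the first argument of the grid function, \<open>y\<close> (height) the second.\<close>

type_synonym grid = "nat \<Rightarrow> nat \<Rightarrow> bool"
type_synonym rect = "nat \<times> nat \<times> nat \<times> nat"

fun empty_rect :: "nat \<Rightarrow> grid \<Rightarrow> rect \<Rightarrow> bool" where
  "empty_rect n f (x1, y1, x2, y2) \<longleftrightarrow>
     x1 \<le> x2 \<and> x2 < n \<and> y1 \<le> y2 \<and> y2 < n \<and> (\<forall>i\<in>{x1..x2}. \<forall>j\<in>{y1..y2}. \<not> f i j)"

fun rect_width :: "rect \<Rightarrow> nat" where
  "rect_width (x1, y1, x2, y2) = x2 - x1 + 1"

fun rect_height :: "rect \<Rightarrow> nat" where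
  "rect_height (x1, y1, x2, y2) = y2 - y1 + 1"

definition rect_area :: "rect \<Rightarrow> nat" where
  "rect_area r = rect_width r * rect_height r"

fun in_rect :: "nat \<Rightarrow> nat \<Rightarrow> rect \<Rightarrow> bool" where
  "in_rect i j (x1, y1, x2, y2) \<longleftrightarrow> x1 \<le> i \<and> i \<le> x2 \<and> y1 \<le> j \<and> j \<le> y2"

fun enclosed_rect :: "nat \<Rightarrow> grid \<Rightarrow> rect \<Rightarrow> bool" where
  "enclosed_rect n f (x1, y1, x2, y2) \<longleftrightarrow>
     (x1 = 0 \<or> (\<forall>j\<in>{y1..y2}. f (x1 - 1) j)) \<and>
     (x2 = n - 1 \<or> (\<forall>j\<in>{y1..y2}. f (x2 + 1) j)) \<and>
     (y1 = 0 \<or> (\<forall>i\<in>{x1..x2}. f i (y1 - 1))) \<and>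
     (y2 = n - 1 \<or> (\<forall>i\<in>{x1..x2}. f i (y2 + 1)))"

definition empty_areas_are_rectangles :: "nat \<Rightarrow> grid \<Rightarrow> bool" where
  "empty_areas_are_rectangles n f \<longleftrightarrow>
     (\<forall>i<n. \<forall>j<n. \<not> f i j \<longleftrightarrow> (\<exists>r. empty_rect n f r \<and> in_rect i j r \<and> enclosed_rect n f r))"

definition admissible_rect :: "nat \<Rightarrow> nat \<Rightarrow> nat \<Rightarrow> grid \<Rightarrow> rect \<Rightarrow> bool" where
  "admissible_rect n h w f r \<longleftrightarrow> empty_rect n f r \<and> h \<le> rect_height r \<and> w \<le> rect_width r"

text \<open>\<open>None\<close> stands for the answer \<open>(NULL, NULL, NULL, NULL)\<close>.\<close>

fun lrec2_correct :: "nat \<Rightarrow> nat \<Rightarrow> nat \<Rightarrow> grid \<Rightarrow> rect option \<Rightarrow> bool" where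
  "lrec2_correct n h w f None \<longleftrightarrow> (\<nexists>r. admissible_rect n h w f r)"
| "lrec2_correct n h w f (Some r) \<longleftrightarrow>
     admissible_rect n h w f r \<and> (\<forall>r'. admissible_rect n h w f r' \<longrightarrow> rect_area r' \<le> rect_area r)"

section \<open>Quantum query model\<close>

text \<open>The input is a bit string of length \<open>N\<close>, given as \<open>x :: nat \<Rightarrow> bool\<close> restricted to \<open>{..<N}\<close>. The
  state space has an index register of dimension \<open>N\<close>, one target qubit and a work register of
  dimension \<open>M\<close>; the basis state \<open>|i>|z>|v>\<close> has number \<open>(i * 2 + z) * M + v\<close>.\<close>

definition basis_number :: "nat \<Rightarrow> nat \<Rightarrow> nat \<Rightarrow> nat \<Rightarrow> nat" where
  "basis_number M i z v = (i * 2 + z) * M + v"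

text \<open>The permutation matrix of \<open>|i>|z>|v> \<mapsto> |i>|z + x\<^sub>i mod 2>|v>\<close>.\<close>

definition query_unitary :: "nat \<Rightarrow> nat \<Rightarrow> (nat \<Rightarrow> bool) \<Rightarrow> complex mat" where
  "query_unitary N M x = mat (N * 2 * M) (N * 2 * M) (\<lambda>(r, c).
     if \<exists>i<N. \<exists>z<2. \<exists>v<M. c = basis_number M i z v \<and>
                           r = basis_number M i ((z + of_bool (x i)) mod 2) v
     then 1 else 0)"

text \<open>The circuit with first gate \<open>U\<^sub>0\<close> and later gates \<open>U\<^sub>1, ..., U\<^sub>T\<close> applies
  \<open>U\<^sub>T O\<^sub>x ... U\<^sub>1 O\<^sub>x U\<^sub>0\<close>, where \<open>O\<^sub>x\<close> is the query unitary; thus it makes \<open>T\<close> queries.\<close>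

record query_circuit =
  work_dim :: nat
  first_gate :: "complex mat"
  later_gates :: "complex mat list"

definition num_queries :: "('a query_circuit_scheme) \<Rightarrow> nat" where
  "num_queries A = length (later_gates A)"

definition circuit_dim :: "nat \<Rightarrow> ('a query_circuit_scheme) \<Rightarrow> nat" where
  "circuit_dim N A = N * 2 * work_dim A"

definition unitary_mat :: "nat \<Rightarrow> complex mat \<Rightarrow> bool" where
  "unitary_mat d U \<longleftrightarrow> U \<in> carrier_mat d d \<and> U * mat_adjoint U = 1\<^sub>m d \<and> mat_adjoint U * U = 1\<^sub>m d"

text \<open>Dimension 0 has no states and must be excluded: every error probability would be 0 there.\<close>

definition valid_circuit :: "nat \<Rightarrow> ('a query_circuit_scheme) \<Rightarrow> bool" where
  "valid_circuit N A \<longleftrightarrow> 0 < circuit_dim N A \<and>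
     unitary_mat (circuit_dim N A) (first_gate A) \<and>
     (\<forall>U \<in> set (later_gates A). unitary_mat (circuit_dim N A) U)"

definition circuit_op :: "nat \<Rightarrow> ('a query_circuit_scheme) \<Rightarrow> (nat \<Rightarrow> bool) \<Rightarrow> complex mat" where
  "circuit_op N A x =
     foldl (\<lambda>V U. U * (query_unitary N (work_dim A) x * V)) (first_gate A) (later_gates A)"

text \<open>An algorithm runs its circuit on basis state 0, measures in the computational basis and
  maps the outcome to an answer.\<close>

record 'o query_algorithm = query_circuit +
  answer :: "nat \<Rightarrow> 'o"

definition error_prob :: "nat \<Rightarrow> 'o query_algorithm \<Rightarrow> ('o \<Rightarrow> bool) \<Rightarrow> (nat \<Rightarrow> bool) \<Rightarrow> real" where
  "error_prob N A correct x =
     (\<Sum>k | k < circuit_dim N A \<and> \<not> correct (answer A k).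
        (cmod ((circuit_op N A x *\<^sub>v unit_vec (circuit_dim N A) 0) $ k))\<^sup>2)"

section \<open>Coherent evaluation of a grid function\<close>

text \<open>\<open>enc i j z\<close> is the number of the basis state that holds the arguments \<open>(i, j)\<close>, the target bit
  \<open>z\<close> and cleared auxiliary registers.\<close>

definition valid_encoding ::
    "nat \<Rightarrow> nat \<Rightarrow> query_circuit \<Rightarrow> (nat \<Rightarrow> nat \<Rightarrow> nat \<Rightarrow> nat) \<Rightarrow> bool" where
  "valid_encoding n N E enc \<longleftrightarrow>
     inj_on (\<lambda>(i, j, z). enc i j z) ({..<n} \<times> {..<n} \<times> {..<2}) \<and>
     (\<forall>i<n. \<forall>j<n. \<forall>z<2. enc i j z < circuit_dim N E)"

text \<open>On the input string \<open>x\<close>, the circuit performs \<open>|i,j>|z> \<mapsto> |i,j>|z + f(i,j) mod 2>\<close>.\<close>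

definition coherently_evaluates :: "nat \<Rightarrow> nat \<Rightarrow> query_circuit \<Rightarrow>
    (nat \<Rightarrow> nat \<Rightarrow> nat \<Rightarrow> nat) \<Rightarrow> (nat \<Rightarrow> bool) \<Rightarrow> grid \<Rightarrow> bool" where
  "coherently_evaluates n N E enc x f \<longleftrightarrow>
     (\<forall>i<n. \<forall>j<n. \<forall>z<2.
        circuit_op N E x *\<^sub>v unit_vec (circuit_dim N E) (enc i j z) =
        unit_vec (circuit_dim N E) (enc i j ((z + of_bool (f i j)) mod 2)))"

text \<open>If the grid function itself is the input string, listed row by row, then a single query is a
  coherent evaluation.\<close>

definition direct_circuit :: "nat \<Rightarrow> query_circuit" where
  "direct_circuit n =
     \<lparr>work_dim = 1, first_gate = 1\<^sub>m (n * n * 2), later_gates = [1\<^sub>m (n * n * 2)]\<rparr>"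

definition direct_encoding :: "nat \<Rightarrow> nat \<Rightarrow> nat \<Rightarrow> nat \<Rightarrow> nat" where
  "direct_encoding n i j z = basis_number 1 (i * n + j) z 0"

lemma num_queries_direct: "num_queries (direct_circuit n) = 1"
  by (simp add: num_queries_def direct_circuit_def)

lemma grid_number_less:
  fixes i j n :: nat
  assumes "i < n" "j < n"
  shows "i * n + j < n * n"
proof -
  have "i * n + j < Suc i * n" using assms by simp
  also have "\<dots> \<le> n * n" using assms by (intro mult_right_mono) auto
  finally show ?thesis .
qed

lemma grid_number_inj:
  fixes i j n :: nat
  assumes "j < n" "j' < n" "i * n + j = i' * n + j'"
  shows "i = i'" "j = j'"
proof -
  have "(i * n + j) div n = i" "(i' * n + j') div n = i'"
    using assms(1,2) by (simp_all add: div_add1_eq)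
  then show "i = i'" using assms(3) by metis
  then show "j = j'" using assms(3) by simp
qed

lemma mat_adjoint_one: "mat_adjoint (1\<^sub>m d :: complex mat) = 1\<^sub>m d"
  by (rule eq_matI) (auto simp: mat_adjoint_def mat_of_rows_def)

lemma valid_direct_circuit: "0 < n \<Longrightarrow> valid_circuit (n * n) (direct_circuit n)"
  by (auto simp: valid_circuit_def circuit_dim_def direct_circuit_def unitary_mat_def mat_adjoint_one)

lemma valid_direct_encoding: "valid_encoding n (n * n) (direct_circuit n) (direct_encoding n)"
  unfolding valid_encoding_def
proof (intro conjI allI impI)
  show "inj_on (\<lambda>(i, j, z). direct_encoding n i j z) ({..<n} \<times> {..<n} \<times> {..<2})"
  proof (rule inj_onI)
    fix p q :: "nat \<times> nat \<times> nat"
    assume pq: "p \<in> {..<n} \<times> {..<n} \<times> {..<2}" "q \<in> {..<n} \<times> {..<n} \<times> {..<2}"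
      and eq: "(\<lambda>(i, j, z). direct_encoding n i j z) p = (\<lambda>(i, j, z). direct_encoding n i j z) q"
    obtain i j z i' j' z' where p: "p = (i, j, z)" and q: "q = (i', j', z')"
      by (cases p, cases q)
    have *: "j < n" "j' < n" "z < 2" "z' < 2" using pq p q by auto
    have eq': "(i * n + j) * 2 + z = (i' * n + j') * 2 + z'"
      using eq p q by (simp add: direct_encoding_def basis_number_def)
    have "a = b \<and> z = z'" if "a * 2 + z = b * 2 + z'" for a b :: nat
      using that *(3,4) by presburger
    from this[OF eq'] have "z = z'" "i * n + j = i' * n + j'" by auto
    then show "p = q" using grid_number_inj[of j n j' i i'] * p q by simp
  qed
next
  fix i j z :: nat
  assume "i < n" "j < n" "z < 2"
  then show "direct_encoding n i j z < circuit_dim (n * n) (direct_circuit n)"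
    using grid_number_less[of i n j]
    by (simp add: direct_encoding_def basis_number_def circuit_dim_def direct_circuit_def)
qed

lemma direct_coherently_evaluates:
  "coherently_evaluates n (n * n) (direct_circuit n) (direct_encoding n) x (\<lambda>i j. x (i * n + j))"
  unfolding coherently_evaluates_def
proof (intro allI impI)
  fix i j z :: nat
  assume ij: "i < n" "j < n" and z: "z < 2"
  let ?d = "n * n * 2" and ?Q = "query_unitary (n * n) 1 x" and ?k = "i * n + j"
  let ?z = "(z + of_bool (x ?k)) mod 2"
  have k: "?k < n * n" using ij by (rule grid_number_less)
  have c: "?Q \<in> carrier_mat ?d ?d" by (simp add: query_unitary_def)
  have op: "circuit_op (n * n) (direct_circuit n) x = ?Q"
    using c by (simp add: circuit_op_def direct_circuit_def)
  have lt: "?k * 2 + z < ?d" using k z by simp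
  have col: "?Q *\<^sub>v unit_vec ?d (?k * 2 + z) = col ?Q (?k * 2 + z)"
    by (rule eq_vecI) (use c lt in auto)
  have uniq: "(i' :: nat) = i'' \<and> z' = z''" if "i' * 2 + z' = i'' * 2 + z''" "z' < 2" "z'' < 2"
    for i' z' i'' z'' :: nat using that by presburger
  have ex: "(\<exists>i'<n * n. \<exists>z'<2. ?k * 2 + z = i' * 2 + z' \<and>
              r = i' * 2 + (z' + of_bool (x i')) mod 2) \<longleftrightarrow> r = ?k * 2 + ?z" for r
    using uniq k z by metis
  have "col ?Q (?k * 2 + z) = unit_vec ?d (?k * 2 + ?z)"
    using lt ex by (intro eq_vecI) (auto simp: query_unitary_def basis_number_def unit_vec_def)
  then show "circuit_op (n * n) (direct_circuit n) x *\<^sub>v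
      unit_vec (circuit_dim (n * n) (direct_circuit n)) (direct_encoding n i j z) =
    unit_vec (circuit_dim (n * n) (direct_circuit n)) (direct_encoding n i j ?z)"
    using op col by (simp add: circuit_dim_def direct_circuit_def direct_encoding_def basis_number_def)
qed

end

theory Submission
  imports Defs "HOL-Combinatorics.Permutations" "HOL-Library.Countable"
begin

text \<open>The empty areas being rectangles, the largest empty rectangle with a given corner cell is found
  by scanning for the first 1 in its row and in its column, and the answer is the best of these \<open>n\<^sup>2\<close>
  rectangles. Scanning has a quantum cost \<open>O(\<surd>n)\<close> and maximum finding over \<open>N\<close> items costs \<open>O(\<surd>N)\<close>
  evaluations. To compose them without a logarithmic overhead, both are treated as solutions of the
  dual adversary bound: the matrix \<open>[F f \<noteq> F g]\<close> is a sum over the cells of kernels that vanish where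
  \<open>f\<close> and \<open>g\<close> agree, and the cost is the size of a factorization of these kernels. Maximum finding averages over
  all orders of the items, so that the \<open>k\<close>-th item is a new maximum with probability at most \<open>1/k\<close>.

  A solution of cost \<open>W\<close> becomes a circuit with \<open>O(W)\<close> queries: its vectors are a catalyst with
  which a query turns a fraction \<open>1/T\<close> of the start state into the answer. Each step preserves
  the Gram matrix of the states over all inputs, hence is realized by an input-independent unitary.
  Omitting the catalyst, whose squared norm is \<open>O(W/T)\<close>, causes only an error of that order.\<close>

section \<open>Signed kernels\<close>

text \<open>Kernels compose exactly: sums add costs, products multiply them, and no error has to be
  controlled before the final circuit. A \<open>signed_kernel\<close> is a difference of two Gram
  matrices, with \<open>a x\<close> bounding the sum of their diagonal entries at \<open>x\<close>.
  The cost is kept as a function of the input, not as a maximum, because the bound for maximum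
  finding holds only after averaging over the orders of the items at one fixed input. The promise
  enters where the computed key is read as a rectangle; the kernels are built for all grids. A
  second obstacle is that the given circuit \<open>E\<close> is specified on encoded basis states
  only. The ideal states stay in the span of these, and the deviation from them, which may leave the
  span, is controlled by its norm alone. All operations are isometries, so the omitted catalyst is
  paid for once and not in every step. Constants: the two scans at a corner cost
  \<open>4 * sqrt n\<close>, and the maximum over \<open>n * n\<close> corners contributes
  \<open>16 * n\<close>, so the kernels cost \<open>W = 64 * n powr 1.5\<close>. The catalyst has
  squared norm at most \<open>W / 2\<close>, and the error is at most four times this divided by
  \<open>T\<close>.\<close>

definition signed_kernel :: "'x set \<Rightarrow> ('x \<Rightarrow> 'x \<Rightarrow> real) \<Rightarrow> ('x \<Rightarrow> real) \<Rightarrow> bool" where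
  "signed_kernel X k a \<longleftrightarrow> (\<exists>(m :: nat) s v.
     (\<forall>l<m. s l = 1 \<or> s l = - 1) \<and>
     (\<forall>x\<in>X. \<forall>y\<in>X. k x y = (\<Sum>l<m. s l * (v l x * v l y))) \<and>
     (\<forall>x\<in>X. (\<Sum>l<m. (v l x)\<^sup>2) \<le> a x))"

text \<open>Arbitrary finite index sets replace initial segments, so that disjoint unions and
  products of representations can be indexed by pairs.\<close>

lemma signed_kernelI:
  fixes L :: "'l set"
  assumes "finite L" and s: "\<And>l. l \<in> L \<Longrightarrow> s l = 1 \<or> s l = - 1"
    and k: "\<And>x y. x \<in> X \<Longrightarrow> y \<in> X \<Longrightarrow> k x y = (\<Sum>l\<in>L. s l * (v l x * v l y))"
    and a: "\<And>x. x \<in> X \<Longrightarrow> (\<Sum>l\<in>L. (v l x)\<^sup>2) \<le> a x"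
  shows "signed_kernel X k a"
proof -
  obtain e where e: "bij_betw e {..<card L} L"
    using ex_bij_betw_nat_finite[OF \<open>finite L\<close>] by (auto simp: atLeast0LessThan)
  show ?thesis
    unfolding signed_kernel_def
  proof (intro exI[of _ "card L"] exI[of _ "\<lambda>l. s (e l)"] exI[of _ "\<lambda>l. v (e l)"] conjI ballI allI impI)
    show "s (e l) = 1 \<or> s (e l) = - 1" if "l < card L" for l
      using s e that by (auto dest: bij_betwE)
    show "k x y = (\<Sum>l<card L. s (e l) * (v (e l) x * v (e l) y))" if "x \<in> X" "y \<in> X" for x y
      using k[OF that] sum.reindex_bij_betw[OF e, of "\<lambda>l. s l * (v l x * v l y)"] by simp
    show "(\<Sum>l<card L. (v (e l) x)\<^sup>2) \<le> a x" if "x \<in> X" for x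
      using a[OF that] sum.reindex_bij_betw[OF e, of "\<lambda>l. (v l x)\<^sup>2"] by simp
  qed
qed

lemma signed_kernelE:
  assumes "signed_kernel X k a"
  obtains m :: nat and s v where "\<And>l. l < m \<Longrightarrow> s l = 1 \<or> s l = - 1"
    "\<And>x y. x \<in> X \<Longrightarrow> y \<in> X \<Longrightarrow> k x y = (\<Sum>l<m. s l * (v l x * v l y))"
    "\<And>x. x \<in> X \<Longrightarrow> (\<Sum>l<m. (v l x)\<^sup>2) \<le> a x"
  using assms unfolding signed_kernel_def by blast

lemma signed_kernel_mono:
  assumes "signed_kernel X k a" "\<And>x y. x \<in> X \<Longrightarrow> y \<in> X \<Longrightarrow> k' x y = k x y" "\<And>x. x \<in> X \<Longrightarrow> a x \<le> a' x"
  shows "signed_kernel X k' a'"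
proof -
  from assms(1) obtain m :: nat and s v where *: "\<And>l. l < m \<Longrightarrow> s l = 1 \<or> s l = - 1"
    "\<And>x y. x \<in> X \<Longrightarrow> y \<in> X \<Longrightarrow> k x y = (\<Sum>l<m. s l * (v l x * v l y))"
    "\<And>x. x \<in> X \<Longrightarrow> (\<Sum>l<m. (v l x)\<^sup>2) \<le> a x"
    by (rule signed_kernelE) blast
  show ?thesis
  proof (rule signed_kernelI[of "{..<m}" s _ _ v])
    show "(\<Sum>l<m. (v l x)\<^sup>2) \<le> a' x" if "x \<in> X" for x
      using *(3)[OF that] assms(3)[OF that] by linarith
  qed (use *(1,2) assms(2) in auto)
qed

lemma signed_kernel_cost_nonneg:
  assumes "signed_kernel X k a" "x \<in> X"
  shows "0 \<le> a x"
proof -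
  from assms(1) obtain m :: nat and s v where
    "\<And>l. l < m \<Longrightarrow> s l = 1 \<or> s l = - 1"
    "\<And>x y. x \<in> X \<Longrightarrow> y \<in> X \<Longrightarrow> k x y = (\<Sum>l<m. s l * (v l x * v l y))"
    "\<And>x. x \<in> X \<Longrightarrow> (\<Sum>l<m. (v l x)\<^sup>2) \<le> a x"
    by (rule signed_kernelE) blast
  then have "(\<Sum>l<m. (v l x)\<^sup>2) \<le> a x" using assms(2) by blast
  moreover have "0 \<le> (\<Sum>l<m. (v l x)\<^sup>2)" by (intro sum_nonneg) auto
  ultimately show ?thesis by simp
qed

lemma signed_kernel_sum:
  assumes "finite I" and sk: "\<And>i. i \<in> I \<Longrightarrow> signed_kernel X (k i) (a i)"
  shows "signed_kernel X (\<lambda>x y. \<Sum>i\<in>I. k i x y) (\<lambda>x. \<Sum>i\<in>I. a i x)"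
proof -
  have "\<forall>i\<in>I. \<exists>(m :: nat) s v.
     (\<forall>l<m. s l = 1 \<or> s l = - 1) \<and>
     (\<forall>x\<in>X. \<forall>y\<in>X. k i x y = (\<Sum>l<m. s l * (v l x * v l y))) \<and>
     (\<forall>x\<in>X. (\<Sum>l<m. (v l x)\<^sup>2) \<le> a i x)"
    using sk unfolding signed_kernel_def by blast
  from bchoice[OF this] obtain m :: "_ \<Rightarrow> nat" where "\<forall>i\<in>I. \<exists>s v.
     (\<forall>l<m i. s l = 1 \<or> s l = - 1) \<and>
     (\<forall>x\<in>X. \<forall>y\<in>X. k i x y = (\<Sum>l<m i. s l * (v l x * v l y))) \<and>
     (\<forall>x\<in>X. (\<Sum>l<m i. (v l x)\<^sup>2) \<le> a i x)" ..
  from bchoice[OF this] obtain s where "\<forall>i\<in>I. \<exists>v.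
     (\<forall>l<m i. s i l = 1 \<or> s i l = - 1) \<and>
     (\<forall>x\<in>X. \<forall>y\<in>X. k i x y = (\<Sum>l<m i. s i l * (v l x * v l y))) \<and>
     (\<forall>x\<in>X. (\<Sum>l<m i. (v l x)\<^sup>2) \<le> a i x)" ..
  from bchoice[OF this] obtain v where *: "\<forall>i\<in>I.
     (\<forall>l<m i. s i l = 1 \<or> s i l = - 1) \<and>
     (\<forall>x\<in>X. \<forall>y\<in>X. k i x y = (\<Sum>l<m i. s i l * (v i l x * v i l y))) \<and>
     (\<forall>x\<in>X. (\<Sum>l<m i. (v i l x)\<^sup>2) \<le> a i x)" ..
  show ?thesis
  proof (rule signed_kernelI[of "SIGMA i:I. {..<m i}" "\<lambda>(i, l). s i l" _ _ "\<lambda>(i, l). v i l"])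
    fix x y assume "x \<in> X" "y \<in> X"
    then show "(\<Sum>i\<in>I. k i x y) = (\<Sum>l\<in>(SIGMA i:I. {..<m i}). (case l of (i, l) \<Rightarrow> s i l) *
        ((case l of (i, l) \<Rightarrow> v i l) x * (case l of (i, l) \<Rightarrow> v i l) y))"
      using \<open>finite I\<close> * by (simp add: split_def) (subst sum.Sigma, auto simp: split_def)
  next
    fix x assume x: "x \<in> X"
    have "(\<Sum>l\<in>(SIGMA i:I. {..<m i}). ((case l of (i, l) \<Rightarrow> v i l) x)\<^sup>2) = (\<Sum>i\<in>I. \<Sum>l<m i. (v i l x)\<^sup>2)"
      using \<open>finite I\<close> by (subst sum.Sigma) (auto simp: split_def)
    also have "\<dots> \<le> (\<Sum>i\<in>I. a i x)" using * x by (intro sum_mono) auto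
    finally show "(\<Sum>l\<in>(SIGMA i:I. {..<m i}). ((case l of (i, l) \<Rightarrow> v i l) x)\<^sup>2) \<le> (\<Sum>i\<in>I. a i x)" .
  qed (use \<open>finite I\<close> * in auto)
qed

lemma signed_kernel_add:
  assumes "signed_kernel X k a" "signed_kernel X k' a'"
  shows "signed_kernel X (\<lambda>x y. k x y + k' x y) (\<lambda>x. a x + a' x)"
proof -
  have "signed_kernel X (\<lambda>x y. \<Sum>b\<in>UNIV. (if b then k else k') x y)
      (\<lambda>x. \<Sum>b\<in>UNIV. (if b then a else a') x)"
    by (rule signed_kernel_sum) (use assms in auto)
  then show ?thesis by (simp add: UNIV_bool add.commute)
qed

text \<open>Tensor products of the two families of vectors represent the product: signs multiply,
  and so do squared norms.\<close>

lemma signed_kernel_mult: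
  assumes "signed_kernel X k a" "signed_kernel X k' a'"
  shows "signed_kernel X (\<lambda>x y. k x y * k' x y) (\<lambda>x. a x * a' x)"
proof -
  from assms(1) obtain m :: nat and s v where *: "\<And>l. l < m \<Longrightarrow> s l = 1 \<or> s l = - 1"
    "\<And>x y. x \<in> X \<Longrightarrow> y \<in> X \<Longrightarrow> k x y = (\<Sum>l<m. s l * (v l x * v l y))"
    "\<And>x. x \<in> X \<Longrightarrow> (\<Sum>l<m. (v l x)\<^sup>2) \<le> a x"
    by (rule signed_kernelE) blast
  from assms(2) obtain m' :: nat and s' v' where #: "\<And>l. l < m' \<Longrightarrow> s' l = 1 \<or> s' l = - 1"
    "\<And>x y. x \<in> X \<Longrightarrow> y \<in> X \<Longrightarrow> k' x y = (\<Sum>l<m'. s' l * (v' l x * v' l y))"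
    "\<And>x. x \<in> X \<Longrightarrow> (\<Sum>l<m'. (v' l x)\<^sup>2) \<le> a' x"
    by (rule signed_kernelE) blast
  show ?thesis
  proof (rule signed_kernelI[of "{..<m} \<times> {..<m'}" "\<lambda>(l, l'). s l * s' l'" _ _ "\<lambda>(l, l') x. v l x * v' l' x"])
    fix x y assume "x \<in> X" "y \<in> X"
    then have "k x y * k' x y = (\<Sum>l<m. \<Sum>l'<m'. (s l * (v l x * v l y)) * (s' l' * (v' l' x * v' l' y)))"
      using *(2) #(2) by (simp only: sum_product)
    also have "\<dots> = (\<Sum>l\<in>{..<m} \<times> {..<m'}. (case l of (l, l') \<Rightarrow> s l * s' l') *
        ((case l of (l, l') \<Rightarrow> \<lambda>x. v l x * v' l' x) x * (case l of (l, l') \<Rightarrow> \<lambda>x. v l x * v' l' x) y))"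
      by (simp add: sum.cartesian_product split_def mult_ac)
    finally show "k x y * k' x y = \<dots>" .
  next
    fix x assume x: "x \<in> X"
    have "(\<Sum>l\<in>{..<m} \<times> {..<m'}. ((case l of (l, l') \<Rightarrow> \<lambda>x. v l x * v' l' x) x)\<^sup>2)
        = (\<Sum>l<m. (v l x)\<^sup>2) * (\<Sum>l<m'. (v' l x)\<^sup>2)"
      by (simp add: sum_product sum.cartesian_product split_def power_mult_distrib)
    also have "\<dots> \<le> a x * a' x"
      using *(3) #(3) x signed_kernel_cost_nonneg[OF assms(1)] by (intro mult_mono sum_nonneg) auto
    finally show "(\<Sum>l\<in>{..<m} \<times> {..<m'}. ((case l of (l, l') \<Rightarrow> \<lambda>x. v l x * v' l' x) x)\<^sup>2) \<le> a x * a' x" .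
  qed (use *(1) #(1) in fastforce)+
qed

lemma signed_kernel_outer: "signed_kernel X (\<lambda>x y. \<alpha> x * \<alpha> y) (\<lambda>x. (\<alpha> x)\<^sup>2)"
  by (rule signed_kernelI[of "{()}" "\<lambda>_. 1" _ _ "\<lambda>_. \<alpha>"]) auto

text \<open>Polarization: the kernel is half the difference of the outer squares of \<alpha> +
  \<beta> and \<alpha> - \<beta>. Scaling \<alpha> up and \<beta> down by the same factor leaves the
  kernel unchanged but shifts cost between two kinds of inputs; the weights \<open>w\<close> and
  \<open>\<omega>\<close> below exploit this freedom.\<close>

lemma signed_kernel_cross:
  "signed_kernel X (\<lambda>x y. \<alpha> x * \<beta> y + \<beta> x * \<alpha> y) (\<lambda>x. (\<alpha> x)\<^sup>2 + (\<beta> x)\<^sup>2)"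
  by (rule signed_kernelI[of "UNIV" "\<lambda>b. if b then 1 else - 1" _ _
        "\<lambda>b x. (if b then \<alpha> x + \<beta> x else \<alpha> x - \<beta> x) / sqrt 2"])
     (auto simp: UNIV_bool field_simps power2_eq_square)

lemma signed_kernel_const:
  assumes "0 \<le> c"
  shows "signed_kernel X (\<lambda>_ _. c) (\<lambda>_. c)"
  using signed_kernel_outer[of X "\<lambda>_. sqrt c"] assms by simp

lemma signed_kernel_scale:
  assumes "0 \<le> c" "signed_kernel X k a"
  shows "signed_kernel X (\<lambda>x y. c * k x y) (\<lambda>x. c * a x)"
  by (rule signed_kernel_mult) (use assms signed_kernel_const in auto)

lemma signed_kernel_eq:
  assumes "finite X"
  shows "signed_kernel X (\<lambda>x y. of_bool (g x = g y)) (\<lambda>_. 1)"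
  by (rule signed_kernelI[of "g ` X" "\<lambda>_. 1" _ _ "\<lambda>l x. of_bool (g x = l)"])
     (use assms in \<open>auto simp: of_bool_def if_distrib[where f = "\<lambda>t. t * _"] if_distrib[where f = "\<lambda>t. t\<^sup>2"] cong: if_cong\<close>)

lemma signed_kernel_neq:
  assumes "finite X"
  shows "signed_kernel X (\<lambda>x y. of_bool (g x \<noteq> g y)) (\<lambda>_. 2)"
proof -
  have "signed_kernel X (\<lambda>_ _. - 1) (\<lambda>_. 1)"
    by (rule signed_kernelI[of "{()}" "\<lambda>_. - 1" _ _ "\<lambda>_ _. 1"]) auto
  from signed_kernel_mult[OF this signed_kernel_eq[OF assms, of g]]
  have "signed_kernel X (\<lambda>x y. 1 + - 1 * of_bool (g x = g y)) (\<lambda>_. 1 + 1 * 1)"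
    by (intro signed_kernel_add signed_kernel_const) auto
  then show ?thesis by (rule signed_kernel_mono) auto
qed

section \<open>Prefix maxima, records in a random order, and the kernel of maximum finding\<close>

primrec prefix_max :: "(nat \<Rightarrow> nat) \<Rightarrow> nat \<Rightarrow> nat" where
  "prefix_max u 0 = 0"
| "prefix_max u (Suc k) = max (prefix_max u k) (u k)"

lemma prefix_max_le_iff: "prefix_max u k \<le> b \<longleftrightarrow> (\<forall>j<k. u j \<le> b)"
  by (induction k) (auto simp: less_Suc_eq)

lemma prefix_max_ge: "j < k \<Longrightarrow> u j \<le> prefix_max u k"
  using prefix_max_le_iff[of u k "prefix_max u k"] by auto

lemma prefix_max_attained: "prefix_max u k = 0 \<or> (\<exists>j<k. prefix_max u k = u j)"
  by (induction k) (auto simp: max_def less_Suc_eq)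

text \<open>This makes averaging over orders legitimate: only the intermediate maxima depend on the
  order, the quantity to be computed does not.\<close>

lemma prefix_max_permute:
  assumes "\<sigma> permutes {..<N}"
  shows "prefix_max (\<lambda>j. u (\<sigma> j)) N = prefix_max u N"
proof -
  have "prefix_max (\<lambda>j. u (\<sigma> j)) N \<le> b \<longleftrightarrow> prefix_max u N \<le> b" for b
  proof -
    have "(\<forall>j\<in>{..<N}. u (\<sigma> j) \<le> b) \<longleftrightarrow> (\<forall>j\<in>\<sigma> ` {..<N}. u j \<le> b)" by blast
    then show ?thesis using permutes_image[OF assms] by (simp add: prefix_max_le_iff Ball_def)
  qed
  then show ?thesis by (meson order_antisym order_refl)
qed

text \<open>Composing with the transposition of \<open>j\<close> and \<open>k\<close> moves each position \<open>j \<le> k\<close> to the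
  end of the prefix of length \<open>Suc k\<close>, and at most one value can be its strict maximum.\<close>

lemma card_record_permutations:
  fixes u :: "nat \<Rightarrow> nat"
  assumes "k < N"
  shows "real (card {\<sigma>. \<sigma> permutes {..<N} \<and> prefix_max (\<lambda>j. u (\<sigma> j)) k < u (\<sigma> k)}) \<le> fact N / real (Suc k)"
proof -
  let ?P = "{\<sigma>. \<sigma> permutes {..<N}}"
  define R where "R \<sigma> \<longleftrightarrow> (\<forall>j<k. u (\<sigma> j) < u (\<sigma> k))" for \<sigma> :: "nat \<Rightarrow> nat"
  have fin: "finite ?P" by (rule finite_permutations) simp
  have reindex: "(\<Sum>\<sigma>\<in>?P. of_bool (R (\<sigma> \<circ> transpose j k))) = (\<Sum>\<sigma>\<in>?P. of_bool (R \<sigma>) :: nat)"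
    if "j \<le> k" for j
  proof -
    have t: "transpose j k permutes {..<N}" using that assms by (intro permutes_swap_id) auto
    have "bij_betw (\<lambda>\<sigma>. \<sigma> \<circ> transpose j k) ?P ?P"
      by (rule bij_betw_byWitness[of _ "\<lambda>\<sigma>. \<sigma> \<circ> transpose j k"])
         (auto simp: o_assoc[symmetric] intro: permutes_compose[OF t])
    then show ?thesis by (rule sum.reindex_bij_betw)
  qed
  have one: "(\<Sum>j\<le>k. of_bool (R (\<sigma> \<circ> transpose j k)) :: nat) \<le> 1" for \<sigma>
  proof -
    have less: "u (\<sigma> i) < u (\<sigma> j)" if "R (\<sigma> \<circ> transpose j k)" "i \<le> k" "j \<le> k" "i \<noteq> j" for i j
    proof -
      have "transpose j k i < k \<or> (i = j)"
        using that by (auto simp: transpose_def)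
      then have "u (\<sigma> (transpose j k (transpose j k i))) < u (\<sigma> (transpose j k k))"
        using that(1,4) unfolding R_def comp_def by blast
      then show ?thesis by simp
    qed
    have "i = j" if "i \<in> {j \<in> {..k}. R (\<sigma> \<circ> transpose j k)}" "j \<in> {j \<in> {..k}. R (\<sigma> \<circ> transpose j k)}" for i j
      using less[of j i] less[of i j] that by fastforce
    then have "card {j \<in> {..k}. R (\<sigma> \<circ> transpose j k)} \<le> Suc 0"
      by (subst card_le_Suc0_iff_eq) auto
    then show ?thesis by (simp add: of_bool_def sum.If_cases Int_def)
  qed
  have "Suc k * (\<Sum>\<sigma>\<in>?P. of_bool (R \<sigma>)) = (\<Sum>j\<le>k. \<Sum>\<sigma>\<in>?P. of_bool (R (\<sigma> \<circ> transpose j k)) :: nat)"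
    by (simp add: reindex)
  also have "\<dots> = (\<Sum>\<sigma>\<in>?P. \<Sum>j\<le>k. of_bool (R (\<sigma> \<circ> transpose j k)))" by (rule sum.swap)
  also have "\<dots> \<le> (\<Sum>\<sigma>\<in>?P. 1)" by (intro sum_mono one)
  also have "\<dots> = fact N" by (simp add: card_permutations)
  finally have "Suc k * card {\<sigma> \<in> ?P. R \<sigma>} \<le> fact N"
    using fin by (simp add: of_bool_def sum.If_cases Int_def)
  moreover have "card {\<sigma>. \<sigma> permutes {..<N} \<and> prefix_max (\<lambda>j. u (\<sigma> j)) k < u (\<sigma> k)} \<le> card {\<sigma> \<in> ?P. R \<sigma>}"
  proof (rule card_mono)
    show "finite {\<sigma> \<in> ?P. R \<sigma>}" using fin by simp
    have "u (\<sigma> j) < u (\<sigma> k)" if "prefix_max (\<lambda>j. u (\<sigma> j)) k < u (\<sigma> k)" "j < k" for \<sigma> j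
      using prefix_max_ge[OF that(2), of "\<lambda>j. u (\<sigma> j)"] that(1) by simp
    then show "{\<sigma>. \<sigma> permutes {..<N} \<and> prefix_max (\<lambda>j. u (\<sigma> j)) k < u (\<sigma> k)} \<subseteq> {\<sigma> \<in> ?P. R \<sigma>}"
      unfolding R_def by auto
  qed
  ultimately have "Suc k * card {\<sigma>. \<sigma> permutes {..<N} \<and> prefix_max (\<lambda>j. u (\<sigma> j)) k < u (\<sigma> k)} \<le> fact N"
    by (meson le_trans mult_le_mono2)
  then have "real (Suc k * card {\<sigma>. \<sigma> permutes {..<N} \<and> prefix_max (\<lambda>j. u (\<sigma> j)) k < u (\<sigma> k)}) \<le> real (fact N)"
    using of_nat_le_iff by blast
  then show ?thesis by (simp add: field_simps)
qed

text \<open>Each term is at most twice the difference of two consecutive square roots, and these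
  differences telescope.\<close>

lemma sum_inverse_sqrt_le: "(\<Sum>k<N. 1 / sqrt (real (Suc k))) \<le> 2 * sqrt (real N)"
proof (induction N)
  case (Suc N)
  let ?a = "sqrt (real N)" and ?b = "sqrt (real (Suc N))"
  have "(?b - ?a) * (?b + ?a) = 1" by (simp add: algebra_simps)
  moreover have b: "?a \<le> ?b" "0 < ?b" "0 \<le> ?a" by auto
  moreover have "(?b - ?a) * (?b + ?a) \<le> (?b - ?a) * (2 * ?b)"
    by (rule mult_left_mono) (use b in auto)
  ultimately have "1 \<le> (?b - ?a) * (2 * ?b)" by simp
  then have "1 / ?b \<le> 2 * (?b - ?a)" using \<open>0 < ?b\<close> by (simp add: field_simps)
  then show ?case using Suc by simp
qed simp

text \<open>The cells are the positions of the input that an algorithm may query. A kernel attached to a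
  cell must vanish on inputs that agree there, since the query does not distinguish them; the sum
  of the kernels over all cells then tells which pairs of inputs are distinguished.\<close>

definition cell_kernels ::
    "'x set \<Rightarrow> 'p set \<Rightarrow> ('x \<Rightarrow> 'p \<Rightarrow> bool) \<Rightarrow> ('p \<Rightarrow> 'x \<Rightarrow> 'x \<Rightarrow> real) \<Rightarrow> real \<Rightarrow> bool" where
  "cell_kernels X P rd K W \<longleftrightarrow>
     (\<forall>p\<in>P. \<forall>x\<in>X. \<forall>y\<in>X. rd x p = rd y p \<longrightarrow> K p x y = 0) \<and>
     (\<exists>a. (\<forall>p\<in>P. signed_kernel X (K p) (a p)) \<and> (\<forall>x\<in>X. (\<Sum>p\<in>P. a p x) \<le> W))"

text \<open>Marks the first step after which the running maxima of two inputs part. Since the whole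
  history has to agree, a pair is charged to at most one step, and summing over the steps yields an
  indicator.\<close>

definition step_kernel :: "('x \<Rightarrow> nat \<Rightarrow> nat) \<Rightarrow> nat \<Rightarrow> 'x \<Rightarrow> 'x \<Rightarrow> real" where
  "step_kernel u k x y = of_bool ((\<forall>j\<le>k. prefix_max (u x) j = prefix_max (u y) j) \<and>
     prefix_max (u x) (Suc k) \<noteq> prefix_max (u y) (Suc k))"

text \<open>Steps that do not change the maximum are cheap (weight \<open>w\<close>); steps that do change it are
  expensive (weight \<open>1 / w\<close>), but rare in a random order.\<close>

lemma signed_kernel_step:
  assumes "finite X" and w: "0 < w" "w \<le> 1"
  shows "signed_kernel X (step_kernel u k)
    (\<lambda>x. w + 3 / w * of_bool (prefix_max (u x) k < u x k))"
proof -
  define \<delta> where "\<delta> x = (prefix_max (u x) k < u x k)" for x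
  let ?eq = "\<lambda>x y. of_bool (map (prefix_max (u x)) [0..<Suc k] = map (prefix_max (u y)) [0..<Suc k]) :: real"
  let ?ne = "\<lambda>x y. of_bool (u x k \<noteq> u y k) :: real"
  let ?\<alpha> = "\<lambda>x. sqrt w * of_bool (\<not> \<delta> x)" and ?\<beta> = "\<lambda>x. of_bool (\<delta> x) / sqrt w"
  let ?d = "\<lambda>x. of_bool (\<delta> x) :: real"
  \<comment> \<open>Given equal maxima so far, the new maxima differ in two cases. Either exactly
    one input has a record, which the cross term detects, or both have one with different values;
    the second term costs 2, but only on inputs with a record.\<close>
  have "signed_kernel X (\<lambda>x y. ?eq x y * ((?\<alpha> x * ?\<beta> y + ?\<beta> x * ?\<alpha> y) + (?d x * ?d y) * ?ne x y))
      (\<lambda>x. 1 * (((?\<alpha> x)\<^sup>2 + (?\<beta> x)\<^sup>2) + (?d x)\<^sup>2 * 2))"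
    by (intro signed_kernel_mult signed_kernel_add signed_kernel_eq signed_kernel_neq
        signed_kernel_cross signed_kernel_outer assms(1))
  then show ?thesis
  proof (rule signed_kernel_mono)
    fix x y
    have "?eq x y = of_bool (\<forall>j\<le>k. prefix_max (u x) j = prefix_max (u y) j)"
      by (auto simp: list_eq_iff_nth_eq less_Suc_eq_le simp del: upt_Suc)
    moreover have "(?\<alpha> x * ?\<beta> y + ?\<beta> x * ?\<alpha> y) + (?d x * ?d y) * ?ne x y =
        of_bool (prefix_max (u x) (Suc k) \<noteq> prefix_max (u y) (Suc k))"
      if "prefix_max (u x) k = prefix_max (u y) k"
      using that w(1) by (auto simp: \<delta>_def max_def)
    ultimately show "step_kernel u k x y =
        ?eq x y * ((?\<alpha> x * ?\<beta> y + ?\<beta> x * ?\<alpha> y) + (?d x * ?d y) * ?ne x y)"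
      unfolding step_kernel_def
      by (cases "\<forall>j\<le>k. prefix_max (u x) j = prefix_max (u y) j") (simp_all only: of_bool_conj of_bool_eq simp_thms mult_zero_left mult_1 order_refl)
  next
    fix x
    have "1 \<le> 1 / w" using w by simp
    moreover have "3 / w = 1 / w + 2 * (1 / w)" by simp
    ultimately have "1 / w + 2 \<le> w + 3 / w" using w by linarith
    then show "1 * (((?\<alpha> x)\<^sup>2 + (?\<beta> x)\<^sup>2) + (?d x)\<^sup>2 * 2) \<le> w + 3 / w * of_bool (prefix_max (u x) k < u x k)"
      using w by (auto simp: \<delta>_def power_divide)
  qed
qed

lemma sum_step_kernel:
  "(\<Sum>k<m. step_kernel u k x y) = of_bool (\<exists>j\<le>m. prefix_max (u x) j \<noteq> prefix_max (u y) j)"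
proof (induction m)
  case (Suc m)
  have "step_kernel u m x y = of_bool ((\<not> (\<exists>j\<le>m. prefix_max (u x) j \<noteq> prefix_max (u y) j)) \<and>
      prefix_max (u x) (Suc m) \<noteq> prefix_max (u y) (Suc m))"
    unfolding step_kernel_def by simp
  moreover have "(\<exists>j\<le>Suc m. prefix_max (u x) j \<noteq> prefix_max (u y) j) \<longleftrightarrow>
      (\<exists>j\<le>m. prefix_max (u x) j \<noteq> prefix_max (u y) j) \<or> prefix_max (u x) (Suc m) \<noteq> prefix_max (u y) (Suc m)"
    by (auto simp: le_Suc_eq simp del: prefix_max.simps)
  ultimately show ?case
    by (simp only: sum.lessThan_Suc Suc.IH) (simp del: prefix_max.simps)
qed simp

text \<open>The kernel of a step is multiplied by the inner kernels of the item examined in it.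
  Where the running maxima part, the values of this item differ, so by \<open>total\<close> the
  inner kernels add up to 1. As \<open>total\<close> speaks of differing values only, the inner
  kernels may distinguish inputs more finely than \<open>val\<close> does. The factor 16 is 2 for
  discarding pairs with equal maxima, times 4 for the average cost \<open>4 * w k\<close> of a step,
  times 2 from summing the weights.\<close>

lemma cell_kernels_maximum:
  fixes val :: "nat \<Rightarrow> 'x \<Rightarrow> nat"
  assumes X: "finite X" and P: "finite P"
    and inner: "\<And>c. c < N \<Longrightarrow> cell_kernels X P rd (\<kappa> c) B"
    and total: "\<And>c x y. c < N \<Longrightarrow> x \<in> X \<Longrightarrow> y \<in> X \<Longrightarrow> val c x \<noteq> val c y \<Longrightarrow> (\<Sum>p\<in>P. \<kappa> c p x y) = 1"
    and B: "0 \<le> B"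
  shows "\<exists>K. cell_kernels X P rd K (16 * B * sqrt (real N)) \<and>
     (\<forall>x\<in>X. \<forall>y\<in>X. (\<Sum>p\<in>P. K p x y) =
        of_bool (prefix_max (\<lambda>c. val c x) N \<noteq> prefix_max (\<lambda>c. val c y) N))"
proof -
  have "\<forall>c\<in>{..<N}. \<exists>b. (\<forall>p\<in>P. signed_kernel X (\<kappa> c p) (b p)) \<and> (\<forall>x\<in>X. (\<Sum>p\<in>P. b p x) \<le> B)"
    using inner unfolding cell_kernels_def by blast
  from bchoice[OF this] obtain b where
    b': "\<forall>c\<in>{..<N}. (\<forall>p\<in>P. signed_kernel X (\<kappa> c p) (b c p)) \<and> (\<forall>x\<in>X. (\<Sum>p\<in>P. b c p x) \<le> B)" ..
  then have b: "\<And>c p. c < N \<Longrightarrow> p \<in> P \<Longrightarrow> signed_kernel X (\<kappa> c p) (b c p)"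
    and bB: "\<And>c x. c < N \<Longrightarrow> x \<in> X \<Longrightarrow> (\<Sum>p\<in>P. b c p x) \<le> B" by blast+
  have \<kappa>0: "\<kappa> c p x y = 0" if "c < N" "p \<in> P" "x \<in> X" "y \<in> X" "rd x p = rd y p" for c p x y
    using inner[OF that(1)] that unfolding cell_kernels_def by blast
  define S where "S = {\<sigma>. \<sigma> permutes {..<N}}"
  have S: "finite S" "card S = fact N" unfolding S_def
    by (auto simp: finite_permutations card_permutations)
  have \<sigma>N: "\<sigma> k < N" if "\<sigma> \<in> S" "k < N" for \<sigma> k
    using that permutes_in_image[of \<sigma> "{..<N}" k] by (auto simp: S_def)
  define u where "u \<sigma> x k = val (\<sigma> k) x" for \<sigma> :: "nat \<Rightarrow> nat" and x k
  \<comment> \<open>A record at step \<open>k\<close> has probability at most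
    \<open>1 / Suc k\<close>, so the step costs at most \<open>w + 3 / (w * Suc k)\<close> on
    average; this choice makes the two terms proportional to each other.\<close>
  define w where "w k = 1 / sqrt (real (Suc k))" for k
  have w: "0 < w k" "w k \<le> 1" for k by (auto simp: w_def)
  define M where "M x = prefix_max (\<lambda>c. val c x) N" for x
  have M: "prefix_max (u \<sigma> x) N = M x" if "\<sigma> \<in> S" for \<sigma> x
    using prefix_max_permute[of \<sigma> N "\<lambda>c. val c x"] that by (simp add: S_def u_def[abs_def] M_def)
  define rec where "rec \<sigma> k x \<longleftrightarrow> prefix_max (u \<sigma> x) k < u \<sigma> x k" for \<sigma> k x
  \<comment> \<open>Two inputs with the same maximum may still have different running maxima in some
    order; the first factor removes such pairs.\<close>
  define K where "K p x y = of_bool (M x \<noteq> M y) * ((1 / fact N) * (\<Sum>\<sigma>\<in>S. \<Sum>k<N.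
      step_kernel (u \<sigma>) k x y * \<kappa> (\<sigma> k) p x y))" for p x y
  define a where "a p x = 2 * ((1 / fact N) * (\<Sum>\<sigma>\<in>S. \<Sum>k<N.
      (w k + 3 / w k * of_bool (rec \<sigma> k x)) * b (\<sigma> k) p x))" for p x
  have sk: "signed_kernel X (K p) (a p)" if "p \<in> P" for p
    unfolding K_def a_def rec_def using S X \<sigma>N b that w
    by (intro signed_kernel_mult signed_kernel_neq signed_kernel_scale signed_kernel_sum signed_kernel_step) auto
  have K0: "K p x y = 0" if "p \<in> P" "x \<in> X" "y \<in> X" "rd x p = rd y p" for p x y
  proof -
    have "(\<Sum>\<sigma>\<in>S. \<Sum>k<N. step_kernel (u \<sigma>) k x y * \<kappa> (\<sigma> k) p x y) = 0"
      using \<kappa>0[OF \<sigma>N that] by (intro sum.neutral ballI) simp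
    then show ?thesis unfolding K_def by simp
  qed
  have Ksum: "(\<Sum>p\<in>P. K p x y) = of_bool (M x \<noteq> M y)" if xy: "x \<in> X" "y \<in> X" for x y
  proof -
    have step: "(\<Sum>p\<in>P. step_kernel (u \<sigma>) k x y * \<kappa> (\<sigma> k) p x y) = step_kernel (u \<sigma>) k x y"
      if "\<sigma> \<in> S" "k < N" for \<sigma> k
    proof (cases "step_kernel (u \<sigma>) k x y = 0")
      case False
      then have *: "(\<forall>j\<le>k. prefix_max (u \<sigma> x) j = prefix_max (u \<sigma> y) j) \<and>
          prefix_max (u \<sigma> x) (Suc k) \<noteq> prefix_max (u \<sigma> y) (Suc k)"
        unfolding step_kernel_def by (simp del: prefix_max.simps)
      then have "prefix_max (u \<sigma> x) k = prefix_max (u \<sigma> y) k" by blast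
      with * have "u \<sigma> x k \<noteq> u \<sigma> y k" by auto
      then have "val (\<sigma> k) x \<noteq> val (\<sigma> k) y" unfolding u_def .
      then show ?thesis using total[OF \<sigma>N[OF that] xy] by (simp add: sum_distrib_left[symmetric])
    qed simp
    have "(\<Sum>p\<in>P. K p x y) = of_bool (M x \<noteq> M y) * ((1 / fact N) *
        (\<Sum>p\<in>P. \<Sum>\<sigma>\<in>S. \<Sum>k<N. step_kernel (u \<sigma>) k x y * \<kappa> (\<sigma> k) p x y))"
      unfolding K_def by (simp add: sum_distrib_left)
    also have "(\<Sum>p\<in>P. \<Sum>\<sigma>\<in>S. \<Sum>k<N. step_kernel (u \<sigma>) k x y * \<kappa> (\<sigma> k) p x y)
        = (\<Sum>\<sigma>\<in>S. \<Sum>p\<in>P. \<Sum>k<N. step_kernel (u \<sigma>) k x y * \<kappa> (\<sigma> k) p x y)"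
      by (rule sum.swap)
    also have "\<dots> = (\<Sum>\<sigma>\<in>S. \<Sum>k<N. \<Sum>p\<in>P. step_kernel (u \<sigma>) k x y * \<kappa> (\<sigma> k) p x y)"
      by (intro sum.cong refl sum.swap)
    also have "\<dots> = (\<Sum>\<sigma>\<in>S. \<Sum>k<N. step_kernel (u \<sigma>) k x y)"
      by (intro sum.cong refl step) auto
    also have "\<dots> = (\<Sum>\<sigma>\<in>S. of_bool (\<exists>j\<le>N. prefix_max (u \<sigma> x) j \<noteq> prefix_max (u \<sigma> y) j))"
      by (simp only: sum_step_kernel)
    also have "of_bool (M x \<noteq> M y) * ((1 / fact N) * \<dots>) = of_bool (M x \<noteq> M y)"
    proof (cases "M x = M y")
      case False
      then have "(\<Sum>\<sigma>\<in>S. of_bool (\<exists>j\<le>N. prefix_max (u \<sigma> x) j \<noteq> prefix_max (u \<sigma> y) j)) = (\<Sum>\<sigma>\<in>S. 1 :: real)"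
      proof (intro sum.cong refl)
        fix \<sigma> assume "\<sigma> \<in> S"
        then have "prefix_max (u \<sigma> x) N \<noteq> prefix_max (u \<sigma> y) N" using M False by simp
        then show "of_bool (\<exists>j\<le>N. prefix_max (u \<sigma> x) j \<noteq> prefix_max (u \<sigma> y) j) = (1 :: real)"
          by (simp only: of_bool_eq_1_iff) blast
      qed
      then show ?thesis by (simp only: S sum_constant) simp
    qed simp
    finally show ?thesis .
  qed
  have cost: "(\<Sum>p\<in>P. a p x) \<le> 16 * B * sqrt (real N)" if x: "x \<in> X" for x
  proof -
    have c0: "0 \<le> w k + 3 / w k * of_bool (rec \<sigma> k x)" for \<sigma> k
      using w[of k] by (auto intro: add_nonneg_nonneg simp: order.strict_implies_order)
    have avg: "(\<Sum>\<sigma>\<in>S. w k + 3 / w k * of_bool (rec \<sigma> k x)) \<le> fact N * (4 * w k)" if "k < N" for k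
    proof -
      have "(\<Sum>\<sigma>\<in>S. of_bool (rec \<sigma> k x)) = real (card {\<sigma> \<in> S. rec \<sigma> k x})"
        by (simp add: S sum.If_cases of_bool_def Int_def)
      moreover have "real (card {\<sigma> \<in> S. rec \<sigma> k x}) \<le> fact N / real (Suc k)"
        using card_record_permutations[OF that, of "\<lambda>c. val c x"] by (simp add: S_def rec_def u_def[abs_def])
      ultimately have "3 / w k * (\<Sum>\<sigma>\<in>S. of_bool (rec \<sigma> k x)) \<le> 3 / w k * (fact N / real (Suc k))"
        using w[of k] by (intro mult_left_mono) auto
      also have "\<dots> = fact N * (3 * w k)"
        by (simp add: w_def field_simps)
      finally have "3 / w k * (\<Sum>\<sigma>\<in>S. of_bool (rec \<sigma> k x)) \<le> fact N * (3 * w k)" .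
      moreover have "(\<Sum>\<sigma>\<in>S. w k + 3 / w k * of_bool (rec \<sigma> k x)) =
          fact N * w k + 3 / w k * (\<Sum>\<sigma>\<in>S. of_bool (rec \<sigma> k x))"
        by (simp only: sum.distrib sum_distrib_left[symmetric] sum_constant S) simp
      ultimately show ?thesis by simp
    qed
    have "(\<Sum>p\<in>P. \<Sum>\<sigma>\<in>S. \<Sum>k<N. (w k + 3 / w k * of_bool (rec \<sigma> k x)) * b (\<sigma> k) p x)
        = (\<Sum>\<sigma>\<in>S. \<Sum>p\<in>P. \<Sum>k<N. (w k + 3 / w k * of_bool (rec \<sigma> k x)) * b (\<sigma> k) p x)"
      by (rule sum.swap)
    also have "\<dots> = (\<Sum>\<sigma>\<in>S. \<Sum>k<N. \<Sum>p\<in>P. (w k + 3 / w k * of_bool (rec \<sigma> k x)) * b (\<sigma> k) p x)"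
      by (intro sum.cong refl sum.swap)
    also have "\<dots> \<le> (\<Sum>\<sigma>\<in>S. \<Sum>k<N. (w k + 3 / w k * of_bool (rec \<sigma> k x)) * B)"
      unfolding sum_distrib_left[symmetric]
      using \<sigma>N x bB c0 by (intro sum_mono mult_left_mono) auto
    also have "\<dots> = (\<Sum>k<N. \<Sum>\<sigma>\<in>S. (w k + 3 / w k * of_bool (rec \<sigma> k x)) * B)" by (rule sum.swap)
    also have "\<dots> = (\<Sum>k<N. (\<Sum>\<sigma>\<in>S. w k + 3 / w k * of_bool (rec \<sigma> k x)) * B)"
      by (simp only: sum_distrib_right)
    also have "\<dots> \<le> (\<Sum>k<N. (fact N * (4 * w k)) * B)"
      using avg B by (intro sum_mono mult_right_mono) auto
    also have "\<dots> = fact N * (4 * B * (\<Sum>k<N. w k))"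
      by (simp add: sum_distrib_left sum_distrib_right mult_ac)
    also have "\<dots> \<le> fact N * (4 * B * (2 * sqrt (real N)))"
      using sum_inverse_sqrt_le[of N] B unfolding w_def by (intro mult_left_mono) auto
    finally have "2 * ((1 / fact N) * (\<Sum>p\<in>P. \<Sum>\<sigma>\<in>S. \<Sum>k<N.
        (w k + 3 / w k * of_bool (rec \<sigma> k x)) * b (\<sigma> k) p x))
      \<le> 2 * ((1 / fact N) * (fact N * (4 * B * (2 * sqrt (real N)))))"
      by (intro mult_left_mono) auto
    moreover have "(\<Sum>p\<in>P. a p x) = 2 * ((1 / fact N) * (\<Sum>p\<in>P. \<Sum>\<sigma>\<in>S. \<Sum>k<N.
        (w k + 3 / w k * of_bool (rec \<sigma> k x)) * b (\<sigma> k) p x))"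
      unfolding a_def by (simp add: sum_distrib_left)
    ultimately show ?thesis by simp
  qed
  show ?thesis
    using sk K0 Ksum cost unfolding cell_kernels_def M_def by blast
qed

section \<open>Kernels for the best corner rectangle\<close>

definition run_length :: "(nat \<Rightarrow> bool) \<Rightarrow> nat \<Rightarrow> nat" where
  "run_length g m = (LEAST d. m \<le> d \<or> g d)"

lemma run_length_le: "run_length g m \<le> m"
  unfolding run_length_def by (rule Least_le) simp

lemma run_length_stops: "run_length g m < m \<Longrightarrow> g (run_length g m)"
  using LeastI[of "\<lambda>d. m \<le> d \<or> g d" m] unfolding run_length_def by auto

lemma run_length_before: "d < run_length g m \<Longrightarrow> \<not> g d"
  using not_less_Least[of d "\<lambda>d. m \<le> d \<or> g d"] unfolding run_length_def by auto

lemma run_length_ge: "(\<And>d. d < l \<Longrightarrow> \<not> g d) \<Longrightarrow> l \<le> m \<Longrightarrow> l \<le> run_length g m"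
  by (metis leI le_trans run_length_stops)

text \<open>Of two different runs, the shorter one stops at a position that the longer one passes,
  and the kernel singles out this position. Its form is that of \<open>signed_kernel_cross\<close>,
  with passing and stopping as the two factors.\<close>

definition scan_kernel :: "('x \<Rightarrow> nat) \<Rightarrow> nat \<Rightarrow> 'x \<Rightarrow> 'x \<Rightarrow> real" where
  "scan_kernel r d x y = of_bool (d < r x) * of_bool (r y = d) + of_bool (r x = d) * of_bool (d < r y)"

lemma sum_scan_kernel:
  assumes "r x \<le> m" "r y \<le> m"
  shows "(\<Sum>d<m. scan_kernel r d x y) = of_bool (r x \<noteq> r y)"
proof -
  have "scan_kernel r d x y = (if d = min (r x) (r y) then of_bool (r x \<noteq> r y) else 0)" for d
    by (auto simp: scan_kernel_def min_def)
  then show ?thesis using assms by (auto simp: sum.delta)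
qed

lemma signed_kernel_scan:
  assumes "0 < \<omega>"
  shows "signed_kernel X (scan_kernel r d) (\<lambda>x. \<omega> * of_bool (d < r x) + of_bool (r x = d) / \<omega>)"
proof -
  have "signed_kernel X (\<lambda>x y. (sqrt \<omega> * of_bool (d < r x)) * (of_bool (r y = d) / sqrt \<omega>) +
      (of_bool (r x = d) / sqrt \<omega>) * (sqrt \<omega> * of_bool (d < r y)))
    (\<lambda>x. (sqrt \<omega> * of_bool (d < r x))\<^sup>2 + (of_bool (r x = d) / sqrt \<omega>)\<^sup>2)"
    by (rule signed_kernel_cross)
  then show ?thesis
    by (rule signed_kernel_mono) (use assms in \<open>auto simp: scan_kernel_def power_mult_distrib power_divide\<close>)
qed

text \<open>Up to \<open>n\<close> positions are passed, each at weight \<open>\<omega>\<close>, but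
  a run stops only once, at weight \<open>1 / \<omega>\<close>.\<close>

lemma scan_cost:
  assumes "0 < \<omega>" "m \<le> n"
  shows "(\<Sum>d<m. \<omega> * of_bool (d < r x) + of_bool (r x = d) / \<omega>) \<le> \<omega> * real n + 1 / \<omega>"
proof -
  have "(\<Sum>d<m. \<omega> * of_bool (d < r x)) \<le> (\<Sum>d<m. \<omega>)" using assms by (intro sum_mono) auto
  also have "\<dots> \<le> \<omega> * real n" using assms by simp
  finally have "(\<Sum>d<m. \<omega> * of_bool (d < r x)) \<le> \<omega> * real n" .
  moreover have "(\<Sum>d<m. of_bool (r x = d) / \<omega>) \<le> 1 / \<omega>"
  proof -
    have "(\<Sum>d<m. of_bool (r x = d) / \<omega>) = (\<Sum>d<m. if d = r x then 1 / \<omega> else 0)"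
      by (intro sum.cong) auto
    then show ?thesis using assms by (simp add: sum.delta)
  qed
  ultimately show ?thesis by (simp add: sum.distrib)
qed

definition read_cell :: "grid \<Rightarrow> nat \<times> nat \<Rightarrow> bool" where
  "read_cell f p = f (fst p) (snd p)"

definition row_run :: "nat \<Rightarrow> nat \<times> nat \<Rightarrow> grid \<Rightarrow> nat" where
  "row_run n c f = run_length (\<lambda>d. f (fst c + d) (snd c)) (n - fst c)"

definition col_run :: "nat \<Rightarrow> nat \<times> nat \<Rightarrow> grid \<Rightarrow> nat" where
  "col_run n c f = run_length (\<lambda>d. f (fst c) (snd c + d)) (n - snd c)"

text \<open>The column scan counts only for pairs with equal row runs; otherwise a pair that differs
  in both runs would be counted twice.\<close>

definition corner_kernel :: "nat \<Rightarrow> nat \<times> nat \<Rightarrow> nat \<times> nat \<Rightarrow> grid \<Rightarrow> grid \<Rightarrow> real" where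
  "corner_kernel n c p f g =
     (\<Sum>d<n - fst c. of_bool (p = (fst c + d, snd c)) * scan_kernel (row_run n c) d f g) +
     of_bool (row_run n c f = row_run n c g) *
       (\<Sum>d<n - snd c. of_bool (p = (fst c, snd c + d)) * scan_kernel (col_run n c) d f g)"

lemma sum_of_bool_cells:
  assumes "\<And>d. d < m \<Longrightarrow> e d \<in> P" "finite P"
  shows "(\<Sum>p\<in>P. \<Sum>d<m. of_bool (p = e d) * t d) = (\<Sum>d<m. (t d :: real))"
proof -
  have "(\<Sum>p\<in>P. \<Sum>d<m. of_bool (p = e d) * t d) = (\<Sum>d<m. \<Sum>p\<in>P. of_bool (p = e d) * t d)"
    by (rule sum.swap)
  also have "\<dots> = (\<Sum>d<m. t d)"
  proof (rule sum.cong[OF refl])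
    fix d assume "d \<in> {..<m}"
    have "(\<Sum>p\<in>P. of_bool (p = e d) * t d) = (\<Sum>p\<in>P. if p = e d then t d else 0)"
      by (intro sum.cong) auto
    also have "\<dots> = t d" using assms \<open>d \<in> _\<close> by simp
    finally show "(\<Sum>p\<in>P. of_bool (p = e d) * t d) = t d" .
  qed
  finally show ?thesis .
qed

lemma sum_corner_kernel:
  assumes "c \<in> {..<n} \<times> {..<n}"
  shows "(\<Sum>p\<in>{..<n} \<times> {..<n}. corner_kernel n c p f g) =
    of_bool (row_run n c f \<noteq> row_run n c g \<or> col_run n c f \<noteq> col_run n c g)"
proof -
  have "(\<Sum>p\<in>{..<n} \<times> {..<n}. corner_kernel n c p f g) =
      (\<Sum>d<n - fst c. scan_kernel (row_run n c) d f g) +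
      of_bool (row_run n c f = row_run n c g) * (\<Sum>d<n - snd c. scan_kernel (col_run n c) d f g)"
    unfolding corner_kernel_def sum.distrib sum_distrib_left[symmetric]
    by (subst (1 2) sum_of_bool_cells) (use assms in auto)
  also have "\<dots> = of_bool (row_run n c f \<noteq> row_run n c g) +
      of_bool (row_run n c f = row_run n c g) * of_bool (col_run n c f \<noteq> col_run n c g)"
    by (subst (1 2) sum_scan_kernel) (auto simp: row_run_def col_run_def run_length_le)
  finally show ?thesis by auto
qed

text \<open>A nonzero scan term means that one run passes the cell, which then holds 0, while the
  other stops there before the border, so that the cell holds 1.\<close>

lemma corner_kernel_agree:
  assumes "read_cell f p = read_cell g p"
  shows "corner_kernel n c p f g = 0"
proof -
  have "scan_kernel (\<lambda>f. run_length (h f) m) d f g = 0" if "d < m" "h f d = h g d" for h m d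
    using that run_length_before[of d "h f" m] run_length_before[of d "h g" m]
      run_length_stops[of "h f" m] run_length_stops[of "h g" m]
    by (auto simp: scan_kernel_def)
  from this[of _ "n - fst c" "\<lambda>f d. f (fst c + d) (snd c)"] this[of _ "n - snd c" "\<lambda>f d. f (fst c) (snd c + d)"]
  have "d < n - fst c \<Longrightarrow> p = (fst c + d, snd c) \<Longrightarrow> scan_kernel (row_run n c) d f g = 0"
    and "d < n - snd c \<Longrightarrow> p = (fst c, snd c + d) \<Longrightarrow> scan_kernel (col_run n c) d f g = 0" for d
    using assms by (simp_all add: row_run_def[abs_def] col_run_def[abs_def] read_cell_def)
  then have "(\<Sum>d<n - fst c. of_bool (p = (fst c + d, snd c)) * scan_kernel (row_run n c) d f g) = 0"
    "(\<Sum>d<n - snd c. of_bool (p = (fst c, snd c + d)) * scan_kernel (col_run n c) d f g) = 0"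
    by (intro sum.neutral; simp)+
  then show ?thesis by (simp add: corner_kernel_def)
qed

lemma cell_kernels_corner:
  assumes X: "finite X" and c: "c \<in> {..<n} \<times> {..<n}"
  shows "cell_kernels X ({..<n} \<times> {..<n}) read_cell (corner_kernel n c) (4 * sqrt (real n))"
proof -
  \<comment> \<open>Balances \<open>\<omega> * n\<close> against \<open>1 / \<omega>\<close>; each
    of the two scans then costs \<open>2 * sqrt n\<close>.\<close>
  define \<omega> where "\<omega> = 1 / sqrt (real n)"
  have n: "0 < n" using c by auto
  have \<omega>: "0 < \<omega>" "\<omega> * real n = sqrt (real n)" "1 / \<omega> = sqrt (real n)"
    using n by (auto simp: \<omega>_def real_div_sqrt)
  let ?c = "\<lambda>r d f. \<omega> * of_bool (d < r f) + of_bool (r f = d) / \<omega>"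
  define a where "a p f = (\<Sum>d<n - fst c. of_bool (p = (fst c + d, snd c)) * ?c (row_run n c) d f) +
     1 * (\<Sum>d<n - snd c. of_bool (p = (fst c, snd c + d)) * ?c (col_run n c) d f)" for p f
  have "signed_kernel X (corner_kernel n c p) (a p)" for p
    unfolding corner_kernel_def[abs_def] a_def[abs_def]
    by (intro signed_kernel_add signed_kernel_sum signed_kernel_scale signed_kernel_mult
        signed_kernel_eq signed_kernel_scan \<omega>(1) X) auto
  moreover have "(\<Sum>p\<in>{..<n} \<times> {..<n}. a p f) \<le> 4 * sqrt (real n)" for f
  proof -
    have "(\<Sum>p\<in>{..<n} \<times> {..<n}. a p f) =
        (\<Sum>d<n - fst c. ?c (row_run n c) d f) + (\<Sum>d<n - snd c. ?c (col_run n c) d f)"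
      unfolding a_def sum.distrib mult_1_left
      by (subst (1 2) sum_of_bool_cells) (use c in \<open>auto simp: sum.distrib\<close>)
    also have "\<dots> \<le> (\<omega> * real n + 1 / \<omega>) + (\<omega> * real n + 1 / \<omega>)"
      by (intro add_mono scan_cost \<omega>) auto
    finally show ?thesis by (simp add: \<omega>)
  qed
  ultimately show ?thesis
    unfolding cell_kernels_def using corner_kernel_agree by blast
qed

section \<open>Corner rectangles as candidates, and their keys\<close>

definition corner_rect :: "nat \<Rightarrow> nat \<times> nat \<Rightarrow> grid \<Rightarrow> rect" where
  "corner_rect n c f = (fst c, snd c, fst c + row_run n c f - 1, snd c + col_run n c f - 1)"

definition rects :: "nat \<Rightarrow> rect set" where
  "rects n = {..<n} \<times> {..<n} \<times> {..<n} \<times> {..<n}"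

text \<open>A key orders rectangles by area and, through the remainder modulo \<open>code_bound\<close>, can be decoded.
  Key 0 stands for no rectangle.\<close>

definition code_bound :: "nat \<Rightarrow> nat" where
  "code_bound n = Suc (Max (insert 0 (to_nat ` rects n)))"

definition rect_key :: "nat \<Rightarrow> rect \<Rightarrow> nat" where
  "rect_key n r = Suc (rect_area r * code_bound n + to_nat r)"

definition key_rect :: "nat \<Rightarrow> nat \<Rightarrow> rect option" where
  "key_rect n k = (if k = 0 then None else Some (from_nat ((k - 1) mod code_bound n)))"

definition corner_value :: "nat \<Rightarrow> nat \<Rightarrow> nat \<Rightarrow> nat \<times> nat \<Rightarrow> grid \<Rightarrow> nat" where
  "corner_value n h w c f =
     (if w \<le> row_run n c f \<and> h \<le> col_run n c f then rect_key n (corner_rect n c f) else 0)"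

definition best_key :: "nat \<Rightarrow> nat \<Rightarrow> nat \<Rightarrow> grid \<Rightarrow> nat" where
  "best_key n h w f = prefix_max (\<lambda>q. corner_value n h w (q div n, q mod n) f) (n * n)"

lemma to_nat_less_code_bound: "r \<in> rects n \<Longrightarrow> to_nat r < code_bound n"
  unfolding code_bound_def less_Suc_eq_le by (rule Max_ge) (auto simp: rects_def)

lemma key_rect_rect_key: "r \<in> rects n \<Longrightarrow> key_rect n (rect_key n r) = Some r"
  using to_nat_less_code_bound by (simp add: key_rect_def rect_key_def)

lemma rect_key_mono: 
  assumes "rect_key n r \<le> rect_key n r'" "r' \<in> rects n"
  shows "rect_area r \<le> rect_area r'"
proof (rule ccontr)
  assume "\<not> ?thesis"
  then have "Suc (rect_area r') * code_bound n \<le> rect_area r * code_bound n"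
    by (intro mult_right_mono) auto
  then show False using assms(1) to_nat_less_code_bound[OF assms(2)] by (simp add: rect_key_def)
qed

text \<open>By the promise, the corner cell lies in an enclosed empty rectangle. Beyond the right
  side of that rectangle is the edge of the grid or a line of 1s crossing the row of the corner, so
  the row run cannot leave it; the same holds for the column run. The rectangle spanned by both runs
  is thus part of an empty one.\<close>

lemma corner_rect_admissible:
  assumes areas: "empty_areas_are_rectangles n f" and c: "c \<in> {..<n} \<times> {..<n}"
    and hw: "1 \<le> h" "1 \<le> w" "w \<le> row_run n c f" "h \<le> col_run n c f"
  shows "admissible_rect n h w f (corner_rect n c f)" "corner_rect n c f \<in> rects n"
proof -
  obtain i j where cij: "c = (i, j)" by (cases c)
  define a b where "a = row_run n c f" and "b = col_run n c f"
  have ij: "i < n" "j < n" using c cij by auto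
  have ab: "1 \<le> a" "1 \<le> b" "w \<le> a" "h \<le> b" using hw a_def b_def by auto
  have row: "\<not> f (i + d) j" if "d < a" for d
    using run_length_before[of d] that unfolding a_def row_run_def cij by force
  have col: "\<not> f i (j + d)" if "d < b" for d
    using run_length_before[of d] that unfolding b_def col_run_def cij by force
  have "a \<le> n - i" "b \<le> n - j"
    unfolding a_def b_def row_run_def col_run_def cij by (simp_all add: run_length_le)
  then have le: "i + a \<le> n" "j + b \<le> n" using ij by auto
  have "\<not> f i j" using row[of 0] ab by simp
  then obtain x1 y1 x2 y2 where r: "empty_rect n f (x1, y1, x2, y2)" "in_rect i j (x1, y1, x2, y2)"
      "enclosed_rect n f (x1, y1, x2, y2)"
    using areas ij unfolding empty_areas_are_rectangles_def by (metis prod_cases4)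
  have x2: "i + a - 1 \<le> x2"
  proof (rule ccontr)
    assume "\<not> ?thesis"
    then have "x2 + 1 - i < a" "x2 \<noteq> n - 1" "x2 + 1 = i + (x2 + 1 - i)" using r(2) le by auto
    then show False using row[of "x2 + 1 - i"] r(2,3) by auto
  qed
  have y2: "j + b - 1 \<le> y2"
  proof (rule ccontr)
    assume "\<not> ?thesis"
    then have "y2 + 1 - j < b" "y2 \<noteq> n - 1" "y2 + 1 = j + (y2 + 1 - j)" using r(2) le by auto
    then show False using col[of "y2 + 1 - j"] r(2,3) by auto
  qed
  show "admissible_rect n h w f (corner_rect n c f)" "corner_rect n c f \<in> rects n"
    using r(1,2) x2 y2 ij ab le
    by (auto simp: admissible_rect_def corner_rect_def rects_def cij a_def[symmetric, unfolded cij] b_def[symmetric, unfolded cij])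
qed

text \<open>The first row and the first column of an empty rectangle are covered by the runs from
  its corner cell. Hence the corner rectangles dominate all candidates.\<close>

lemma admissible_le_corner_rect:
  assumes "admissible_rect n h w f (x1, y1, x2, y2)"
  shows "(x1, y1) \<in> {..<n} \<times> {..<n}"
    "w \<le> row_run n (x1, y1) f" "h \<le> col_run n (x1, y1) f"
    "rect_area (x1, y1, x2, y2) \<le> rect_area (corner_rect n (x1, y1) f)"
proof -
  have r: "x1 \<le> x2" "x2 < n" "y1 \<le> y2" "y2 < n" "w \<le> x2 - x1 + 1" "h \<le> y2 - y1 + 1"
    and e: "\<And>i j. x1 \<le> i \<Longrightarrow> i \<le> x2 \<Longrightarrow> y1 \<le> j \<Longrightarrow> j \<le> y2 \<Longrightarrow> \<not> f i j"
    using assms by (auto simp: admissible_rect_def)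
  have a: "x2 - x1 + 1 \<le> row_run n (x1, y1) f"
  proof -
    have "\<not> f (x1 + d) y1" if "d < x2 - x1 + 1" for d using e[of "x1 + d" y1] that r by auto
    then show ?thesis unfolding row_run_def using r by (intro run_length_ge) auto
  qed
  have b: "y2 - y1 + 1 \<le> col_run n (x1, y1) f"
  proof -
    have "\<not> f x1 (y1 + d)" if "d < y2 - y1 + 1" for d using e[of x1 "y1 + d"] that r by auto
    then show ?thesis unfolding col_run_def using r by (intro run_length_ge) auto
  qed
  show "(x1, y1) \<in> {..<n} \<times> {..<n}"
    "w \<le> row_run n (x1, y1) f" "h \<le> col_run n (x1, y1) f" using a b r by auto
  have "rect_width (corner_rect n (x1, y1) f) = row_run n (x1, y1) f"
    "rect_height (corner_rect n (x1, y1) f) = col_run n (x1, y1) f"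
    using a b by (auto simp: corner_rect_def)
  then show "rect_area (x1, y1, x2, y2) \<le> rect_area (corner_rect n (x1, y1) f)"
    unfolding rect_area_def using a b by (simp add: mult_mono del: One_nat_def)
qed

lemma best_key_correct:
  assumes areas: "empty_areas_are_rectangles n f" and hw: "1 \<le> h" "1 \<le> w"
  shows "lrec2_correct n h w f (key_rect n (best_key n h w f))"
proof -
  let ?c = "\<lambda>q. (q div n, q mod n)"
  have cell: "?c q \<in> {..<n} \<times> {..<n}" if "q < n * n" for q
    using that by (cases n) (auto simp: less_mult_imp_div_less)
  have dominated: "\<exists>r'. rect_key n r' \<le> best_key n h w f \<and> rect_area r \<le> rect_area r'"
    if "admissible_rect n h w f r" for r
  proof -
    obtain x1 y1 x2 y2 where r: "r = (x1, y1, x2, y2)" by (cases r)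
    note * = admissible_le_corner_rect[OF that[unfolded r]]
    have q: "x1 * n + y1 < n * n" "?c (x1 * n + y1) = (x1, y1)"
      using *(1) grid_number_less by auto
    have "corner_value n h w (x1, y1) f \<le> best_key n h w f"
      unfolding best_key_def using prefix_max_ge[OF q(1), of "\<lambda>q. corner_value n h w (?c q) f"] q(2) by simp
    then show ?thesis using * r by (intro exI[of _ "corner_rect n (x1, y1) f"]) (simp add: corner_value_def)
  qed
  show ?thesis
  proof (cases "best_key n h w f = 0")
    case True
    \<comment> \<open>An admissible rectangle would force some key, which is a successor, to be at
      most 0.\<close>
    then show ?thesis using dominated by (fastforce simp: key_rect_def rect_key_def)
  next
    case False
    then obtain q where q: "q < n * n" "best_key n h w f = corner_value n h w (?c q) f"
      using prefix_max_attained[of "\<lambda>q. corner_value n h w (?c q) f" "n * n"] unfolding best_key_def by auto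
    let ?r = "corner_rect n (?c q) f"
    have runs: "w \<le> row_run n (?c q) f" "h \<le> col_run n (?c q) f" and key: "best_key n h w f = rect_key n ?r"
      using q(2) False by (auto simp: corner_value_def split: if_splits)
    note adm = corner_rect_admissible[OF areas cell[OF q(1)] hw runs]
    have "rect_area r \<le> rect_area ?r" if "admissible_rect n h w f r" for r
      using dominated[OF that] rect_key_mono[OF _ adm(2)] key by fastforce
    then show ?thesis using adm by (simp add: key key_rect_rect_key)
  qed
qed

text \<open>The factors are \<open>4 * sqrt n\<close> for one corner and
  \<open>16 * sqrt (n * n)\<close> for the maximum over all corners.\<close>

lemma cell_kernels_best_key:
  assumes "finite X" "1 \<le> n"
  shows "\<exists>K. cell_kernels X ({..<n} \<times> {..<n}) read_cell K (64 * (real n * sqrt (real n))) \<and>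
     (\<forall>f\<in>X. \<forall>g\<in>X. (\<Sum>p\<in>{..<n} \<times> {..<n}. K p f g) = of_bool (best_key n h w f \<noteq> best_key n h w g))"
proof -
  let ?c = "\<lambda>q. (q div n, q mod n)"
  have cell: "?c q \<in> {..<n} \<times> {..<n}" if "q < n * n" for q
    using that assms by (auto simp: less_mult_imp_div_less)
  have "\<exists>K. cell_kernels X ({..<n} \<times> {..<n}) read_cell K (16 * (4 * sqrt (real n)) * sqrt (real (n * n))) \<and>
     (\<forall>f\<in>X. \<forall>g\<in>X. (\<Sum>p\<in>{..<n} \<times> {..<n}. K p f g) =
       of_bool (prefix_max (\<lambda>q. corner_value n h w (?c q) f) (n * n) \<noteq>
         prefix_max (\<lambda>q. corner_value n h w (?c q) g) (n * n)))"
  proof (rule cell_kernels_maximum)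
    fix q f g assume "q < n * n" "corner_value n h w (?c q) f \<noteq> corner_value n h w (?c q) g"
    \<comment> \<open>The value depends on the grid only through the two runs, and these are what
      the corner kernel distinguishes.\<close>
    moreover from this(2) have "row_run n (?c q) f \<noteq> row_run n (?c q) g \<or> col_run n (?c q) f \<noteq> col_run n (?c q) g"
      by (auto simp: corner_value_def corner_rect_def split: if_splits)
    ultimately show "(\<Sum>p\<in>{..<n} \<times> {..<n}. corner_kernel n (?c q) p f g) = 1"
      using sum_corner_kernel[OF cell] by simp
  qed (use assms cell_kernels_corner cell in auto)
  then show ?thesis by (simp add: best_key_def real_sqrt_mult mult_ac)
qed

section \<open>Unitary circuits\<close>

lemma mult_mat_entry:
  assumes "A \<in> carrier_mat a b" "B \<in> carrier_mat b c" "i < a" "j < c"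
  shows "(A * B) $$ (i, j) = (\<Sum>k<b. A $$ (i, k) * B $$ (k, j))"
  using assms by (auto simp: scalar_prod_def atLeast0LessThan)

lemma mult_mat_vec_entry:
  assumes "A \<in> carrier_mat a b" "v \<in> carrier_vec b" "i < a"
  shows "(A *\<^sub>v v) $ i = (\<Sum>k<b. A $$ (i, k) * v $ k)"
  using assms by (auto simp: scalar_prod_def atLeast0LessThan)

lemma mat_adjoint_carrier: "A \<in> carrier_mat a b \<Longrightarrow> mat_adjoint A \<in> carrier_mat b a"
  unfolding mat_adjoint_def by (intro carrier_matI) auto

lemma mat_adjoint_entry:
  assumes "(A :: complex mat) \<in> carrier_mat a b" "i < b" "j < a"
  shows "mat_adjoint A $$ (i, j) = cnj (A $$ (j, i))"
  using assms by (auto simp: mat_adjoint_def mat_of_rows_def)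

lemma mat_adjoint_mult:
  assumes A: "(A :: complex mat) \<in> carrier_mat a b" and B: "B \<in> carrier_mat b c"
  shows "mat_adjoint (A * B) = mat_adjoint B * mat_adjoint A"
proof (rule eq_matI)
  note carr = mat_adjoint_carrier[OF A] mat_adjoint_carrier[OF B]
  fix i j assume "i < dim_row (mat_adjoint B * mat_adjoint A)" "j < dim_col (mat_adjoint B * mat_adjoint A)"
  then have ij: "i < c" "j < a" using carr by auto
  have "mat_adjoint (A * B) $$ (i, j) = cnj ((A * B) $$ (j, i))"
    by (rule mat_adjoint_entry) (use A B ij in auto)
  also have "\<dots> = (\<Sum>k<b. cnj (A $$ (j, k)) * cnj (B $$ (k, i)))"
    by (subst mult_mat_entry[OF A B ij(2,1)]) simp
  also have "\<dots> = (\<Sum>k<b. mat_adjoint B $$ (i, k) * mat_adjoint A $$ (k, j))"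
    by (intro sum.cong refl) (simp add: mat_adjoint_entry[OF A] mat_adjoint_entry[OF B] ij mult.commute)
  also have "\<dots> = (mat_adjoint B * mat_adjoint A) $$ (i, j)"
    using mult_mat_entry[OF carr(2,1) ij] by simp
  finally show "mat_adjoint (A * B) $$ (i, j) = (mat_adjoint B * mat_adjoint A) $$ (i, j)" .
qed (use mat_adjoint_carrier[of "A * B" a c] mat_adjoint_carrier[OF A] mat_adjoint_carrier[OF B] A B in auto)

lemma unitary_mat_mult:
  assumes "unitary_mat d U" "unitary_mat d V"
  shows "unitary_mat d (U * V)"
proof -
  let ?U = "mat_adjoint U" and ?V = "mat_adjoint V"
  have U: "U \<in> carrier_mat d d" "U * ?U = 1\<^sub>m d" "?U * U = 1\<^sub>m d"
    and V: "V \<in> carrier_mat d d" "V * ?V = 1\<^sub>m d" "?V * V = 1\<^sub>m d"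
    using assms by (auto simp: unitary_mat_def)
  have U': "?U \<in> carrier_mat d d" and V': "?V \<in> carrier_mat d d"
    using U(1) V(1) by (auto intro: mat_adjoint_carrier)
  have adj: "mat_adjoint (U * V) = ?V * ?U" by (rule mat_adjoint_mult[OF U(1) V(1)])
  have "(U * V) * (?V * ?U) = U * ((V * ?V) * ?U)"
    using U(1) V(1) U' V' by (simp add: assoc_mult_mat[of _ d d _ d _ d])
  also have "\<dots> = 1\<^sub>m d" using U V(2) U' by simp
  finally have 1: "(U * V) * (?V * ?U) = 1\<^sub>m d" .
  have "(?V * ?U) * (U * V) = ?V * ((?U * U) * V)"
    using U(1) V(1) U' V' by (simp add: assoc_mult_mat[of _ d d _ d _ d])
  also have "\<dots> = 1\<^sub>m d" using U V V' by simp
  finally show ?thesis using 1 U(1) V(1) unfolding unitary_mat_def adj by auto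
qed

definition sq_norm :: "complex vec \<Rightarrow> real" where
  "sq_norm v = (\<Sum>i<dim_vec v. (cmod (v $ i))\<^sup>2)"

lemma sq_norm_unitary:
  assumes U: "unitary_mat d U" and v: "v \<in> carrier_vec d"
  shows "sq_norm (U *\<^sub>v v) = sq_norm v"
proof -
  have Uc: "U \<in> carrier_mat d d" and UU: "mat_adjoint U * U = 1\<^sub>m d"
    using U by (auto simp: unitary_mat_def)
  have orth: "(\<Sum>i<d. U $$ (i, j) * cnj (U $$ (i, k))) = of_bool (j = k)" if "j < d" "k < d" for j k
  proof -
    have "(\<Sum>i<d. U $$ (i, j) * cnj (U $$ (i, k))) = (\<Sum>i<d. mat_adjoint U $$ (k, i) * U $$ (i, j))"
      by (intro sum.cong refl) (simp add: mat_adjoint_entry[OF Uc] that mult.commute)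
    also have "\<dots> = (mat_adjoint U * U) $$ (k, j)"
      using mult_mat_entry[OF mat_adjoint_carrier[OF Uc] Uc] that by simp
    finally show ?thesis using UU that by auto
  qed
  have "complex_of_real (sq_norm (U *\<^sub>v v)) = (\<Sum>i<d. (U *\<^sub>v v) $ i * cnj ((U *\<^sub>v v) $ i))"
    using Uc by (simp add: sq_norm_def complex_norm_square[symmetric] del: of_real_power)
  also have "\<dots> = (\<Sum>i<d. (\<Sum>j<d. U $$ (i, j) * v $ j) * (\<Sum>k<d. cnj (U $$ (i, k)) * cnj (v $ k)))"
    by (intro sum.cong refl) (simp add: mult_mat_vec_entry[OF Uc v] del: index_mult_mat_vec)
  also have "\<dots> = (\<Sum>i<d. \<Sum>j<d. \<Sum>k<d. (v $ j * cnj (v $ k)) * (U $$ (i, j) * cnj (U $$ (i, k))))"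
    by (simp add: sum_product mult_ac)
  also have "\<dots> = (\<Sum>j<d. \<Sum>i<d. \<Sum>k<d. (v $ j * cnj (v $ k)) * (U $$ (i, j) * cnj (U $$ (i, k))))"
    by (rule sum.swap)
  also have "\<dots> = (\<Sum>j<d. \<Sum>k<d. \<Sum>i<d. (v $ j * cnj (v $ k)) * (U $$ (i, j) * cnj (U $$ (i, k))))"
    by (intro sum.cong refl sum.swap)
  also have "\<dots> = (\<Sum>j<d. \<Sum>k<d. (v $ j * cnj (v $ k)) * of_bool (j = k))"
    unfolding sum_distrib_left[symmetric] by (intro sum.cong refl) (simp add: orth)
  also have "\<dots> = (\<Sum>j<d. v $ j * cnj (v $ j))"
    by (intro sum.cong refl) (simp add: of_bool_def if_distrib[where f = "\<lambda>t. _ * t"] cong: if_cong)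
  also have "\<dots> = complex_of_real (sq_norm v)"
    using v by (simp add: sq_norm_def complex_norm_square[symmetric] del: of_real_power)
  finally show ?thesis by (simp only: of_real_eq_iff)
qed

lemma sq_norm_diff_le:
  assumes "v \<in> carrier_vec d" "w \<in> carrier_vec d"
  shows "sq_norm (v - w) \<le> 2 * sq_norm v + 2 * sq_norm w"
proof -
  have "(cmod (a - b))\<^sup>2 \<le> 2 * (cmod a)\<^sup>2 + 2 * (cmod b)\<^sup>2" for a b
  proof -
    have "(cmod (a - b))\<^sup>2 \<le> (cmod a + cmod b)\<^sup>2"
      by (intro power_mono norm_triangle_ineq4) simp
    also have "\<dots> \<le> 2 * (cmod a)\<^sup>2 + 2 * (cmod b)\<^sup>2"
      using sum_squares_bound[of "cmod a" "cmod b"] by (simp add: power2_sum)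
    finally show ?thesis .
  qed
  then have "(\<Sum>i<d. (cmod (v $ i - w $ i))\<^sup>2) \<le> (\<Sum>i<d. 2 * (cmod (v $ i))\<^sup>2 + 2 * (cmod (w $ i))\<^sup>2)"
    by (intro sum_mono)
  then show ?thesis using assms by (simp add: sq_norm_def sum.distrib sum_distrib_left)
qed

section \<open>The query as a permutation of basis states\<close>

definition query_shift :: "nat \<Rightarrow> (nat \<Rightarrow> bool) \<Rightarrow> nat \<Rightarrow> nat" where
  "query_shift M x r =
     basis_number M (r div M div 2) ((r div M mod 2 + of_bool (x (r div M div 2))) mod 2) (r mod M)"

lemma basis_number_decode:
  assumes "z < 2" "v < M"
  shows "basis_number M i z v div M div 2 = i" "basis_number M i z v div M mod 2 = z"
    "basis_number M i z v mod M = v"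
  using assms by (auto simp: basis_number_def div_mult_self3 div_add1_eq)

lemma basis_number_encode: "basis_number M (r div M div 2) (r div M mod 2) (r mod M) = r"
  by (simp add: basis_number_def mult.commute[of _ 2] mult.commute[of _ M])

lemma basis_number_less:
  assumes "i < N" "z < 2" "v < M"
  shows "basis_number M i z v < N * 2 * M"
proof -
  have "basis_number M i z v < (i * 2 + z + 1) * M" using assms by (simp add: basis_number_def)
  also have "\<dots> \<le> N * 2 * M" using assms by (intro mult_right_mono) auto
  finally show ?thesis .
qed

lemma basis_index_less: "r < N * 2 * M \<Longrightarrow> r div M div 2 < (N :: nat)"
  by (intro less_mult_imp_div_less)

lemma query_shift_less:
  assumes "r < N * 2 * M"
  shows "query_shift M x r < N * 2 * M"
proof -
  have "0 < M" using assms by (auto intro: gr0I)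
  then show ?thesis
    unfolding query_shift_def using assms by (intro basis_number_less basis_index_less) auto
qed

lemma query_shift_involution: "0 < M \<Longrightarrow> query_shift M x (query_shift M x r) = r"
proof -
  assume M: "0 < M"
  have "((z + b) mod 2 + b) mod 2 = z" if "z < 2" for z b :: nat using that by presburger
  then show ?thesis
    using M basis_number_encode[of M r] unfolding query_shift_def by (simp add: basis_number_decode)
qed

lemma query_unitary_eq:
  "query_unitary N M x = mat (N * 2 * M) (N * 2 * M) (\<lambda>(r, c). of_bool (r = query_shift M x c))"
proof (rule eq_matI)
  fix r c assume "r < dim_row (mat (N * 2 * M) (N * 2 * M) (\<lambda>(r, c). of_bool (r = query_shift M x c) :: complex))"
    "c < dim_col (mat (N * 2 * M) (N * 2 * M) (\<lambda>(r, c). of_bool (r = query_shift M x c) :: complex))"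
  then have rc: "r < N * 2 * M" "c < N * 2 * M" by auto
  then have M: "0 < M" by (auto intro: gr0I)
  have "(\<exists>i<N. \<exists>z<2. \<exists>v<M. c = basis_number M i z v \<and>
      r = basis_number M i ((z + of_bool (x i)) mod 2) v) \<longleftrightarrow> r = query_shift M x c" (is "?L \<longleftrightarrow> ?R")
  proof
    assume ?L
    then show ?R by (auto simp: query_shift_def basis_number_decode)
  next
    assume ?R
    then show ?L
      using basis_number_encode[of M c] basis_index_less[OF rc(2)] M
      by (intro exI[of _ "c div M div 2"] conjI exI[of _ "c div M mod 2"] exI[of _ "c mod M"])
         (auto simp: query_shift_def)
  qed
  then show "query_unitary N M x $$ (r, c) =
      mat (N * 2 * M) (N * 2 * M) (\<lambda>(r, c). of_bool (r = query_shift M x c)) $$ (r, c)"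
    using rc by (simp add: query_unitary_def)
qed (auto simp: query_unitary_def)

lemma query_unitary_carrier: "query_unitary N M x \<in> carrier_mat (N * 2 * M) (N * 2 * M)"
  by (simp add: query_unitary_def)

lemma sq_norm_query:
  assumes v: "v \<in> carrier_vec (N * 2 * M)"
  shows "sq_norm (query_unitary N M x *\<^sub>v v) = sq_norm v"
proof (cases "M = 0")
  case True
  then show ?thesis using v by (simp add: sq_norm_def query_unitary_def)
next
  case False
  let ?d = "N * 2 * M" and ?s = "query_shift M x"
  have inv: "?s (?s r) = r" for r using False by (simp add: query_shift_involution)
  have entry: "(query_unitary N M x *\<^sub>v v) $ r = v $ ?s r" if r: "r < ?d" for r
  proof -
    have "(query_unitary N M x *\<^sub>v v) $ r = (\<Sum>c<?d. of_bool (r = ?s c) * v $ c)"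
      by (subst mult_mat_vec_entry[OF query_unitary_carrier v r]) (simp add: query_unitary_eq r)
    also have "\<dots> = (\<Sum>c<?d. if c = ?s r then v $ c else 0)"
      by (intro sum.cong refl) (auto simp: inv)
    also have "\<dots> = v $ ?s r" using query_shift_less[OF r] by simp
    finally show ?thesis .
  qed
  have "bij_betw ?s {..<?d} {..<?d}"
    by (rule bij_betw_byWitness[of _ ?s]) (auto simp: inv query_shift_less)
  from sum.reindex_bij_betw[OF this, of "\<lambda>r. (cmod (v $ r))\<^sup>2"]
  moreover have "dim_vec (query_unitary N M x *\<^sub>v v) = ?d" by (simp add: query_unitary_def)
  ultimately show ?thesis using v by (simp add: sq_norm_def entry del: index_mult_mat_vec dim_mult_mat_vec)
qed

section \<open>Tensoring with an idle register\<close>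

lemma sum_div_mod:
  fixes g :: "nat \<Rightarrow> 'b :: comm_monoid_add"
  shows "(\<Sum>m<n * K. g m) = (\<Sum>e<n. \<Sum>k<K. g (e * K + k))"
proof -
  have "(\<Sum>k<K. g (e * K + k)) = sum g {e * K..<e * K + K}" for e
    by (rule sum.reindex_bij_witness[of _ "\<lambda>m. m - e * K" "\<lambda>k. e * K + k"]) auto
  then show ?thesis by (simp add: sum.nat_group)
qed

text \<open>The Kronecker product of \<open>A\<close> with the identity of dimension
  \<open>K\<close>. The idle register is the least significant digit of the index, as the work
  register is in \<open>basis_number\<close>, so it can be absorbed into the work register.\<close>

definition pad_mat :: "nat \<Rightarrow> 'a :: zero mat \<Rightarrow> 'a mat" where
  "pad_mat K A = mat (dim_row A * K) (dim_col A * K)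
     (\<lambda>(r, c). if r mod K = c mod K then A $$ (r div K, c div K) else 0)"

lemma pad_mat_carrier: "A \<in> carrier_mat a b \<Longrightarrow> pad_mat K A \<in> carrier_mat (a * K) (b * K)"
  by (simp add: pad_mat_def)

lemma pad_mat_entry:
  assumes "A \<in> carrier_mat a b" "r < a * K" "c < b * K"
  shows "pad_mat K A $$ (r, c) = (if r mod K = c mod K then A $$ (r div K, c div K) else 0)"
  using assms by (simp add: pad_mat_def)

lemma pad_mat_sum:
  fixes A :: "'a :: semiring_0 mat"
  assumes A: "A \<in> carrier_mat a b" and r: "r < a * K"
  shows "(\<Sum>m<b * K. pad_mat K A $$ (r, m) * g m) = (\<Sum>e<b. A $$ (r div K, e) * g (e * K + r mod K))"
proof -
  have K: "r mod K < K" using r by (cases "K = 0") auto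
  have less: "e * K + k < b * K" if "e < b" "k < K" for e k
  proof -
    have "e * K + k < Suc e * K" using that by simp
    also have "\<dots> \<le> b * K" using that by (intro mult_right_mono) auto
    finally show ?thesis .
  qed
  have "(\<Sum>m<b * K. pad_mat K A $$ (r, m) * g m) =
      (\<Sum>e<b. \<Sum>k<K. if k = r mod K then A $$ (r div K, e) * g (e * K + k) else 0)"
    unfolding sum_div_mod by (intro sum.cong refl) (auto simp: pad_mat_entry[OF A r] less)
  then show ?thesis using K by simp
qed

lemma pad_mat_mult_vec:
  fixes A :: "'a :: comm_semiring_0 mat"
  assumes A: "A \<in> carrier_mat a b" and v: "v \<in> carrier_vec (b * K)" and r: "r < a * K"
  shows "(pad_mat K A *\<^sub>v v) $ r = (\<Sum>e<b. A $$ (r div K, e) * v $ (e * K + r mod K))"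
  using mult_mat_vec_entry[OF pad_mat_carrier[OF A] v r] pad_mat_sum[OF A r, of "\<lambda>m. v $ m"] by simp

lemma pad_mat_mult:
  fixes A :: "'a :: comm_semiring_0 mat"
  assumes A: "A \<in> carrier_mat a b" and B: "B \<in> carrier_mat b c"
  shows "pad_mat K (A * B) = pad_mat K A * pad_mat K B"
proof (rule eq_matI)
  note carr = pad_mat_carrier[OF A, of K] pad_mat_carrier[OF B, of K]
  fix r s assume "r < dim_row (pad_mat K A * pad_mat K B)" "s < dim_col (pad_mat K A * pad_mat K B)"
  then have rs: "r < a * K" "s < c * K" using carr by auto
  then have K: "0 < K" by (auto intro: gr0I)
  have div: "r div K < a" "s div K < c" using rs by (auto simp: less_mult_imp_div_less)
  have less: "e * K + r mod K < b * K" if "e < b" for e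
  proof -
    have "e * K + r mod K < Suc e * K" using K by simp
    also have "\<dots> \<le> b * K" using that by (intro mult_right_mono) auto
    finally show ?thesis .
  qed
  have "(pad_mat K A * pad_mat K B) $$ (r, s) = (\<Sum>m<b * K. pad_mat K A $$ (r, m) * pad_mat K B $$ (m, s))"
    by (rule mult_mat_entry[OF carr rs])
  also have "\<dots> = (\<Sum>e<b. A $$ (r div K, e) * pad_mat K B $$ (e * K + r mod K, s))"
    by (rule pad_mat_sum[OF A rs(1)])
  also have "\<dots> = (\<Sum>e<b. if r mod K = s mod K then A $$ (r div K, e) * B $$ (e, s div K) else 0)"
    using K by (intro sum.cong refl) (simp add: pad_mat_entry[OF B] less rs)
  also have "\<dots> = pad_mat K (A * B) $$ (r, s)"
    using mult_mat_entry[OF A B div] pad_mat_entry[of "A * B" a c r K s] A B rs by (simp del: index_mult_mat)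
  finally show "pad_mat K (A * B) $$ (r, s) = (pad_mat K A * pad_mat K B) $$ (r, s)" ..
qed (use A B in \<open>auto simp: pad_mat_def\<close>)

lemma pad_mat_one: "pad_mat K (1\<^sub>m d) = 1\<^sub>m (d * K)"
proof (rule eq_matI)
  fix r s assume rs: "r < dim_row (1\<^sub>m (d * K))" "s < dim_col (1\<^sub>m (d * K))"
  have "r = s" if "r mod K = s mod K" "r div K = s div K" using that by (metis div_mult_mod_eq)
  then show "pad_mat K (1\<^sub>m d) $$ (r, s) = 1\<^sub>m (d * K) $$ (r, s)"
    using rs by (auto simp: pad_mat_def less_mult_imp_div_less)
qed (auto simp: pad_mat_def)

lemma pad_mat_adjoint:
  assumes A: "(A :: complex mat) \<in> carrier_mat a b"
  shows "mat_adjoint (pad_mat K A) = pad_mat K (mat_adjoint A)"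
proof (rule eq_matI)
  fix r s assume "r < dim_row (pad_mat K (mat_adjoint A))" "s < dim_col (pad_mat K (mat_adjoint A))"
  then have rs: "r < b * K" "s < a * K" using mat_adjoint_carrier[OF A] by (auto simp: pad_mat_def)
  then have "r div K < b" "s div K < a" by (auto simp: less_mult_imp_div_less)
  then show "mat_adjoint (pad_mat K A) $$ (r, s) = pad_mat K (mat_adjoint A) $$ (r, s)"
    by (simp add: mat_adjoint_entry[OF pad_mat_carrier[OF A]] rs pad_mat_entry[OF A]
        pad_mat_entry[OF mat_adjoint_carrier[OF A]] mat_adjoint_entry[OF A])
qed (use A mat_adjoint_carrier[OF A] mat_adjoint_carrier[OF pad_mat_carrier[OF A, of K]] in \<open>auto simp: pad_mat_def\<close>)

lemma unitary_pad_mat: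
  assumes "unitary_mat d U"
  shows "unitary_mat (d * K) (pad_mat K U)"
proof -
  have U: "U \<in> carrier_mat d d" "U * mat_adjoint U = 1\<^sub>m d" "mat_adjoint U * U = 1\<^sub>m d"
    using assms by (auto simp: unitary_mat_def)
  have "mat_adjoint U \<in> carrier_mat d d" using U(1) by (rule mat_adjoint_carrier)
  then show ?thesis
    using U pad_mat_mult[of U d d "mat_adjoint U" d K] pad_mat_mult[of "mat_adjoint U" d d U d K]
    by (simp add: unitary_mat_def pad_mat_carrier pad_mat_adjoint pad_mat_one)
qed

lemma query_shift_pad:
  assumes "0 < K"
  shows "query_shift (M * K) x r = query_shift M x (r div K) * K + r mod K"
proof -
  have "r div (M * K) = r div K div M" by (simp add: div_mult2_eq mult.commute[of M])
  moreover have "r mod (M * K) = r div K mod M * K + r mod K"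
    using mod_mult2_eq[of r K M] by (simp add: mult.commute)
  ultimately show ?thesis
    by (simp add: query_shift_def basis_number_def algebra_simps)
qed

text \<open>A query leaves the work register alone, so it makes no difference whether the idle
  register is counted as part of it. Hence a padded circuit makes genuine queries.\<close>

lemma query_unitary_pad: "query_unitary N (M * K) x = pad_mat K (query_unitary N M x)"
proof (rule eq_matI)
  let ?Q = "query_unitary N M x"
  fix r s assume "r < dim_row (pad_mat K ?Q)" "s < dim_col (pad_mat K ?Q)"
  then have rs: "r < N * 2 * M * K" "s < N * 2 * M * K" by (auto simp: pad_mat_def query_unitary_def)
  then have K: "0 < K" by (auto intro: gr0I)
  have div: "r div K < N * 2 * M" "s div K < N * 2 * M" using rs by (auto simp: less_mult_imp_div_less)
  have "r = q * K + s mod K \<longleftrightarrow> r mod K = s mod K \<and> r div K = q" for q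
  proof
    assume "r mod K = s mod K \<and> r div K = q"
    then show "r = q * K + s mod K" using div_mult_mod_eq[of r K] by simp
  qed (use K in simp)
  then show "query_unitary N (M * K) x $$ (r, s) = pad_mat K ?Q $$ (r, s)"
    using rs div pad_mat_entry[OF query_unitary_carrier[of N M x], of r K s]
    by (simp add: query_unitary_eq query_shift_pad[OF K] mult.assoc)
qed (auto simp: pad_mat_def query_unitary_def)

section \<open>Gate sequences and their concatenation\<close>

type_synonym gates = "complex mat \<times> complex mat list"

definition gates_op :: "nat \<Rightarrow> nat \<Rightarrow> (nat \<Rightarrow> bool) \<Rightarrow> gates \<Rightarrow> complex mat" where
  "gates_op N M x P = foldl (\<lambda>V U. U * (query_unitary N M x * V)) (fst P) (snd P)"

definition unitary_gates :: "nat \<Rightarrow> gates \<Rightarrow> bool" where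
  "unitary_gates d P \<longleftrightarrow> unitary_mat d (fst P) \<and> (\<forall>U\<in>set (snd P). unitary_mat d U)"

text \<open>The circuit format puts a query between any two consecutive gates. Merging the last gate
  of \<open>P\<close> with the first gate of \<open>R\<close> avoids an extra query, and the query
  counts simply add up.\<close>

definition append_gates :: "gates \<Rightarrow> gates \<Rightarrow> gates" where
  "append_gates P R = (if snd P = [] then (fst R * fst P, snd R)
     else (fst P, butlast (snd P) @ [fst R * last (snd P)] @ snd R))"

definition pad_gates :: "nat \<Rightarrow> gates \<Rightarrow> gates" where
  "pad_gates K P = (pad_mat K (fst P), map (pad_mat K) (snd P))"

lemma length_append_gates: "length (snd (append_gates P R)) = length (snd P) + length (snd R)"
  by (simp add: append_gates_def)

lemma unitary_append_gates:
  assumes "unitary_gates d P" "unitary_gates d R"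
  shows "unitary_gates d (append_gates P R)"
  using assms unfolding unitary_gates_def append_gates_def
  by (auto intro: unitary_mat_mult dest: in_set_butlastD)

lemma unitary_pad_gates: "unitary_gates d P \<Longrightarrow> unitary_gates (d * K) (pad_gates K P)"
  by (auto simp: unitary_gates_def pad_gates_def unitary_pad_mat)

context
  fixes N M :: nat and x :: "nat \<Rightarrow> bool" and d :: nat
  defines "d \<equiv> N * 2 * M"
begin

abbreviation "query_step \<equiv> \<lambda>V U. U * (query_unitary N M x * V)"

lemma foldl_gates_carrier:
  assumes "V \<in> carrier_mat d d" "\<forall>U\<in>set Us. unitary_mat d U"
  shows "foldl query_step V Us \<in> carrier_mat d d"
  using assms
proof (induction Us arbitrary: V)
  case (Cons U Us)
  have "U \<in> carrier_mat d d" using Cons.prems by (simp add: unitary_mat_def)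
  then show ?case
    using Cons query_unitary_carrier[of N M x] unfolding foldl_Cons
    by (intro Cons.IH) (auto simp: d_def)
qed simp

lemma gates_op_carrier: "unitary_gates d P \<Longrightarrow> gates_op N M x P \<in> carrier_mat d d"
  unfolding gates_op_def by (rule foldl_gates_carrier) (auto simp: unitary_gates_def unitary_mat_def)

lemma foldl_gates_mult:
  assumes "A \<in> carrier_mat d d" "B \<in> carrier_mat d d" "\<forall>U\<in>set Us. unitary_mat d U"
  shows "foldl query_step (A * B) Us = foldl query_step A Us * B"
  using assms
proof (induction Us arbitrary: A)
  case (Cons U Us)
  have U: "U \<in> carrier_mat d d" and Q: "query_unitary N M x \<in> carrier_mat d d"
    using Cons.prems by (auto simp: unitary_mat_def d_def query_unitary_carrier)
  have "query_step (A * B) U = query_step A U * B"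
    using U Q Cons.prems by (simp add: assoc_mult_mat[of _ d d _ d _ d])
  moreover have "query_step A U \<in> carrier_mat d d" using U Q Cons.prems by simp
  ultimately show ?case using Cons.IH[of "query_step A U"] Cons.prems by simp
qed simp

lemma gates_op_append:
  assumes P: "unitary_gates d P" and R: "unitary_gates d R"
  shows "gates_op N M x (append_gates P R) = gates_op N M x R * gates_op N M x P"
proof -
  have c: "fst P \<in> carrier_mat d d" "fst R \<in> carrier_mat d d" and us: "\<forall>U\<in>set (snd R). unitary_mat d U"
    using P R by (auto simp: unitary_gates_def unitary_mat_def)
  have Q: "query_unitary N M x \<in> carrier_mat d d" by (simp add: d_def query_unitary_carrier)
  show ?thesis
  proof (cases "snd P" rule: rev_cases)
    case Nil
    then show ?thesis using foldl_gates_mult[OF c(2,1) us] by (simp add: gates_op_def append_gates_def)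
  next
    case (snoc Us U)
    have U: "U \<in> carrier_mat d d" and Us: "\<forall>U\<in>set Us. unitary_mat d U"
      using P snoc by (auto simp: unitary_gates_def unitary_mat_def)
    define V where "V = foldl query_step (fst P) Us"
    have V: "V \<in> carrier_mat d d" unfolding V_def by (rule foldl_gates_carrier[OF c(1) Us])
    have "(fst R * U) * (query_unitary N M x * V) = fst R * (U * (query_unitary N M x * V))"
      using c(2) U Q V by (simp add: assoc_mult_mat[of _ d d _ d _ d])
    moreover have "U * (query_unitary N M x * V) \<in> carrier_mat d d" using U Q V by simp
    ultimately show ?thesis
      using foldl_gates_mult[OF c(2) _ us, of "U * (query_unitary N M x * V)"] snoc
      by (simp add: gates_op_def append_gates_def V_def[symmetric])
  qed
qed

lemma sq_norm_foldl_gates: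
  assumes "V \<in> carrier_mat d d" "\<And>v. v \<in> carrier_vec d \<Longrightarrow> sq_norm (V *\<^sub>v v) = sq_norm v"
    "\<forall>U\<in>set Us. unitary_mat d U" "v \<in> carrier_vec d"
  shows "sq_norm (foldl query_step V Us *\<^sub>v v) = sq_norm v"
  using assms
proof (induction Us arbitrary: V)
  case (Cons U Us)
  have U: "U \<in> carrier_mat d d" "unitary_mat d U" and Q: "query_unitary N M x \<in> carrier_mat d d"
    using Cons.prems by (auto simp: unitary_mat_def d_def query_unitary_carrier)
  have "sq_norm (query_step V U *\<^sub>v v) = sq_norm v" if v: "v \<in> carrier_vec d" for v
  proof -
    have "query_step V U *\<^sub>v v = U *\<^sub>v (query_unitary N M x *\<^sub>v (V *\<^sub>v v))"
      using U Q Cons.prems v by (simp add: assoc_mult_mat_vec[of _ d d _ d])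
    moreover have "V *\<^sub>v v \<in> carrier_vec d" "query_unitary N M x *\<^sub>v (V *\<^sub>v v) \<in> carrier_vec d"
      using Q Cons.prems v by auto
    ultimately show ?thesis
      using sq_norm_unitary[OF U(2)] sq_norm_query[of "V *\<^sub>v v" N M x] Cons.prems(2)[OF v]
      by (simp add: d_def)
  qed
  moreover have "query_step V U \<in> carrier_mat d d" using U Q Cons.prems by simp
  ultimately show ?case using Cons.IH[of "query_step V U"] Cons.prems by simp
qed simp

lemma sq_norm_gates_op:
  assumes "unitary_gates d P" "v \<in> carrier_vec d"
  shows "sq_norm (gates_op N M x P *\<^sub>v v) = sq_norm v"
proof -
  have U: "unitary_mat d (fst P)" and Us: "\<forall>U\<in>set (snd P). unitary_mat d U"
    using assms(1) by (auto simp: unitary_gates_def)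
  have "fst P \<in> carrier_mat d d" using U by (simp add: unitary_mat_def)
  then show ?thesis
    unfolding gates_op_def using sq_norm_unitary[OF U] Us assms(2) by (rule sq_norm_foldl_gates)
qed

lemma gates_op_pad:
  assumes "unitary_gates d P"
  shows "gates_op N (M * K) x (pad_gates K P) = pad_mat K (gates_op N M x P)"
proof -
  have Q: "query_unitary N M x \<in> carrier_mat d d" by (simp add: d_def query_unitary_carrier)
  have "foldl (\<lambda>V U. U * (query_unitary N (M * K) x * V)) (pad_mat K V) (map (pad_mat K) Us) =
      pad_mat K (foldl query_step V Us)"
    if "V \<in> carrier_mat d d" "\<forall>U\<in>set Us. unitary_mat d U" for V Us
    using that
  proof (induction Us arbitrary: V)
    case (Cons U Us)
    have U: "U \<in> carrier_mat d d" using Cons.prems by (auto simp: unitary_mat_def)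
    have QV: "query_unitary N M x * V \<in> carrier_mat d d" using Q Cons.prems by simp
    have "pad_mat K U * (query_unitary N (M * K) x * pad_mat K V) = pad_mat K (query_step V U)"
      using pad_mat_mult[OF U QV, of K] pad_mat_mult[OF Q Cons.prems(1), of K] by (simp add: query_unitary_pad)
    moreover have "query_step V U \<in> carrier_mat d d" using U QV by simp
    ultimately show ?case using Cons.IH[of "query_step V U"] Cons.prems by simp
  qed simp
  then show ?thesis using assms by (auto simp: gates_op_def pad_gates_def unitary_gates_def unitary_mat_def[of d "fst P"])
qed

end

section \<open>Equal Gram matrices\<close>

definition orthogonal_mat :: "nat \<Rightarrow> real mat \<Rightarrow> bool" where
  "orthogonal_mat d R \<longleftrightarrow> R \<in> carrier_mat d d \<and> R * transpose_mat R = 1\<^sub>m d \<and> transpose_mat R * R = 1\<^sub>m d"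

lemma orthogonal_mat_one: "orthogonal_mat d (1\<^sub>m d)"
  by (simp add: orthogonal_mat_def)

lemma orthogonal_mat_mult:
  assumes "orthogonal_mat d R" "orthogonal_mat d S"
  shows "orthogonal_mat d (R * S)"
proof -
  let ?R = "transpose_mat R" and ?S = "transpose_mat S"
  have R: "R \<in> carrier_mat d d" "?R \<in> carrier_mat d d" "R * ?R = 1\<^sub>m d" "?R * R = 1\<^sub>m d"
    and S: "S \<in> carrier_mat d d" "?S \<in> carrier_mat d d" "S * ?S = 1\<^sub>m d" "?S * S = 1\<^sub>m d"
    using assms by (auto simp: orthogonal_mat_def)
  have t: "transpose_mat (R * S) = ?S * ?R" by (rule transpose_mult[OF R(1) S(1)])
  have "(R * S) * (?S * ?R) = R * ((S * ?S) * ?R)"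
    using R(1,2) S(1,2) by (simp add: assoc_mult_mat[of _ d d _ d _ d])
  then have 1: "(R * S) * (?S * ?R) = 1\<^sub>m d" using R S(3) by simp
  have "(?S * ?R) * (R * S) = ?S * ((?R * R) * S)"
    using R(1,2) S(1,2) by (simp add: assoc_mult_mat[of _ d d _ d _ d])
  then have "(?S * ?R) * (R * S) = 1\<^sub>m d" using R(4) S by simp
  then show ?thesis using 1 R(1) S(1) by (simp add: orthogonal_mat_def t)
qed

lemma orthogonal_mat_scalar_prod:
  assumes "orthogonal_mat d R" and v: "v \<in> carrier_vec d" and w: "w \<in> carrier_vec d"
  shows "(R *\<^sub>v v) \<bullet> (R *\<^sub>v w) = v \<bullet> w"
proof -
  have R: "R \<in> carrier_mat d d" "transpose_mat R * R = 1\<^sub>m d" using assms by (auto simp: orthogonal_mat_def)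
  have "(R *\<^sub>v v) \<bullet> (R *\<^sub>v w) = (transpose_mat R *\<^sub>v (R *\<^sub>v v)) \<bullet> w"
    by (rule transpose_vec_mult_scalar[symmetric]) (use R v w in auto)
  also have "transpose_mat R *\<^sub>v (R *\<^sub>v v) = (transpose_mat R * R) *\<^sub>v v"
    by (rule assoc_mult_mat_vec[symmetric]) (use R v in auto)
  finally show ?thesis using R v by simp
qed

lemma unitary_orthogonal_mat:
  assumes "orthogonal_mat d R"
  shows "unitary_mat d (map_mat complex_of_real R)"
proof -
  let ?c = "map_mat complex_of_real"
  have R: "R \<in> carrier_mat d d" "R * transpose_mat R = 1\<^sub>m d" "transpose_mat R * R = 1\<^sub>m d"
    using assms by (auto simp: orthogonal_mat_def)
  have adj: "mat_adjoint (?c R) = ?c (transpose_mat R)"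
    using R(1) mat_adjoint_carrier[of "?c R" d d] by (intro eq_matI) (auto simp: mat_adjoint_entry[of _ d d])
  have "?c R * ?c (transpose_mat R) = ?c (R * transpose_mat R)"
    by (rule of_real_hom.mat_hom_mult[symmetric]) (use R(1) in auto)
  moreover have "?c (transpose_mat R) * ?c R = ?c (transpose_mat R * R)"
    by (rule of_real_hom.mat_hom_mult[symmetric]) (use R(1) in auto)
  ultimately show ?thesis
    using R by (simp add: unitary_mat_def adj of_real_hom.mat_hom_one)
qed

text \<open>The Householder reflection in the hyperplane orthogonal to \<open>v\<close>. For
  \<open>v = 0\<close> the convention \<open>2 / 0 = 0\<close> turns it into the identity, so it is
  orthogonal in every case.\<close>

definition reflection_mat :: "nat \<Rightarrow> real vec \<Rightarrow> real mat" where
  "reflection_mat d v = mat d d (\<lambda>(i, j). of_bool (i = j) - 2 / (v \<bullet> v) * (v $ i * v $ j))"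

lemma reflection_mat_mult_vec:
  assumes v: "v \<in> carrier_vec d" and w: "w \<in> carrier_vec d"
  shows "reflection_mat d v *\<^sub>v w = w - (2 * (v \<bullet> w) / (v \<bullet> v)) \<cdot>\<^sub>v v"
proof (rule eq_vecI)
  have c: "reflection_mat d v \<in> carrier_mat d d" by (simp add: reflection_mat_def)
  fix i assume "i < dim_vec (w - (2 * (v \<bullet> w) / (v \<bullet> v)) \<cdot>\<^sub>v v)"
  then have i: "i < d" using v by simp
  have "(reflection_mat d v *\<^sub>v w) $ i = (\<Sum>k<d. reflection_mat d v $$ (i, k) * w $ k)"
    by (rule mult_mat_vec_entry[OF c w i])
  also have "\<dots> = (\<Sum>k<d. (if k = i then w $ k else 0) - 2 / (v \<bullet> v) * v $ i * (v $ k * w $ k))"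
    by (intro sum.cong refl) (use i in \<open>auto simp: reflection_mat_def algebra_simps\<close>)
  also have "\<dots> = w $ i - 2 / (v \<bullet> v) * v $ i * (v \<bullet> w)"
    using i w by (simp add: sum_subtractf sum_distrib_left scalar_prod_def atLeast0LessThan)
  finally show "(reflection_mat d v *\<^sub>v w) $ i = (w - (2 * (v \<bullet> w) / (v \<bullet> v)) \<cdot>\<^sub>v v) $ i"
    using i v w by simp
qed (use v in \<open>simp add: reflection_mat_def\<close>)

lemma orthogonal_reflection_mat:
  assumes v: "v \<in> carrier_vec d"
  shows "orthogonal_mat d (reflection_mat d v)"
proof -
  let ?R = "reflection_mat d v" and ?s = "2 / (v \<bullet> v)"
  have c: "?R \<in> carrier_mat d d" by (simp add: reflection_mat_def)
  have t: "transpose_mat ?R = ?R" by (rule eq_matI) (auto simp: reflection_mat_def)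
  have "?R * ?R = 1\<^sub>m d"
  proof (rule eq_matI)
    fix i j assume "i < dim_row (1\<^sub>m d)" "j < dim_col (1\<^sub>m d)"
    then have ij: "i < d" "j < d" by auto
    have "(?R * ?R) $$ (i, j) = (\<Sum>k<d. ?R $$ (i, k) * ?R $$ (k, j))"
      by (rule mult_mat_entry[OF c c ij])
    also have "\<dots> = (\<Sum>k<d. (if k = i then of_bool (i = j) - ?s * (v $ i * v $ j) else 0) -
        (if k = j then ?s * (v $ i * v $ j) else 0) + ?s * ?s * (v $ i * v $ j) * (v $ k * v $ k))"
      by (intro sum.cong refl) (use ij in \<open>auto simp: reflection_mat_def algebra_simps\<close>)
    also have "\<dots> = of_bool (i = j) - 2 * (?s * (v $ i * v $ j)) + ?s * ?s * (v $ i * v $ j) * (v \<bullet> v)"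
      using ij v by (simp add: sum.distrib sum_subtractf sum_distrib_left scalar_prod_def atLeast0LessThan)
    also have "\<dots> = of_bool (i = j)" by (cases "v \<bullet> v = 0") (auto simp: field_simps)
    finally show "(?R * ?R) $$ (i, j) = 1\<^sub>m d $$ (i, j)" using ij by simp
  qed (use c in auto)
  then show ?thesis using c by (simp add: orthogonal_mat_def t)
qed

text \<open>The transformation is built one vector at a time: the reflection along the difference of the
  current image of the new vector and its target fixes all earlier targets, to which this difference is orthogonal.\<close>

lemma equal_gram_imp_orthogonal_mat:
  fixes a b :: "'x \<Rightarrow> real vec"
  assumes "finite X" and "\<And>x. x \<in> X \<Longrightarrow> a x \<in> carrier_vec d" "\<And>x. x \<in> X \<Longrightarrow> b x \<in> carrier_vec d"
    and "\<And>x y. x \<in> X \<Longrightarrow> y \<in> X \<Longrightarrow> a x \<bullet> a y = b x \<bullet> b y"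
  shows "\<exists>R. orthogonal_mat d R \<and> (\<forall>x\<in>X. R *\<^sub>v a x = b x)"
  using assms
proof (induction X)
  case empty
  then show ?case using orthogonal_mat_one by blast
next
  case (insert x X)
  then obtain R where R: "orthogonal_mat d R" "\<And>y. y \<in> X \<Longrightarrow> R *\<^sub>v a y = b y" by auto
  have Rc: "R \<in> carrier_mat d d" using R(1) by (simp add: orthogonal_mat_def)
  have a: "a y \<in> carrier_vec d" and b: "b y \<in> carrier_vec d" if "y = x \<or> y \<in> X" for y
    using insert.prems that by auto
  define a' where "a' = R *\<^sub>v a x"
  have a': "a' \<in> carrier_vec d" using Rc a[of x] by (simp add: a'_def)
  have bx: "b x \<in> carrier_vec d" using b by simp
  define v where "v = a' - b x"
  have v: "v \<in> carrier_vec d" using a' bx by (simp add: v_def)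
  have a'b: "a' \<bullet> b y = b x \<bullet> b y" if "y \<in> X" for y
  proof -
    have "a' \<bullet> b y = (R *\<^sub>v a x) \<bullet> (R *\<^sub>v a y)" using R(2)[OF that] by (simp add: a'_def)
    also have "\<dots> = a x \<bullet> a y" by (rule orthogonal_mat_scalar_prod[OF R(1)]) (use a that in auto)
    finally show ?thesis using insert.prems(3) that by simp
  qed
  have aa: "a' \<bullet> a' = b x \<bullet> b x"
    using orthogonal_mat_scalar_prod[OF R(1), of "a x" "a x"] a[of x] insert.prems(3)[of x x] by (simp add: a'_def)
  have comm: "a' \<bullet> b x = b x \<bullet> a'" by (rule comm_scalar_prod[OF a' bx])
  have va: "v \<bullet> a' = b x \<bullet> b x - a' \<bullet> b x"
    using minus_scalar_prod_distrib[OF a' bx a'] by (simp add: v_def aa comm)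
  \<comment> \<open>Because \<open>a'\<close> and \<open>b x\<close> have the same norm, the
    projection of \<open>a'\<close> to \<open>v\<close> is \<open>v / 2\<close>; the reflection
    therefore sends \<open>a'\<close> to \<open>a' - v = b x\<close>.\<close>
  have vv: "v \<bullet> v = 2 * (v \<bullet> a')"
    using scalar_prod_minus_distrib[OF v a' bx] minus_scalar_prod_distrib[OF a' bx bx] va
    by (simp add: v_def[symmetric])
  let ?H = "reflection_mat d v"
  have Hc: "?H \<in> carrier_mat d d" by (simp add: reflection_mat_def)
  have "?H *\<^sub>v a' = b x"
  proof (cases "v \<bullet> v = 0")
    case True
    then have "(\<Sum>i<d. v $ i * v $ i) = 0" using v by (simp add: scalar_prod_def atLeast0LessThan)
    then have "\<forall>i<d. v $ i * v $ i = 0" by (subst (asm) sum_nonneg_eq_0_iff) auto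
    then have v0: "v $ i = 0" if "i < d" for i using that by simp
    have "a' = b x"
    proof (rule eq_vecI)
      show "a' $ i = b x $ i" if "i < dim_vec (b x)" for i
        using v0[of i] that bx a' by (simp add: v_def)
    qed (use a' bx in auto)
    then show ?thesis
      using True reflection_mat_mult_vec[OF v a'] a' v by (auto intro!: eq_vecI)
  next
    case False
    then have "2 * (v \<bullet> a') / (v \<bullet> v) = 1" by (simp add: vv)
    then show ?thesis
      using reflection_mat_mult_vec[OF v a'] a' bx by (auto simp: v_def intro!: eq_vecI)
  qed
  moreover have "?H *\<^sub>v b y = b y" if "y \<in> X" for y
  proof -
    have by': "b y \<in> carrier_vec d" using b that by simp
    have "v \<bullet> b y = 0" using minus_scalar_prod_distrib[OF a' bx by'] a'b[OF that] by (simp add: v_def)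
    then show ?thesis using reflection_mat_mult_vec[OF v by'] by' v by (auto intro!: eq_vecI)
  qed
  moreover have "(?H * R) *\<^sub>v a y = ?H *\<^sub>v (R *\<^sub>v a y)" if "y = x \<or> y \<in> X" for y
    by (rule assoc_mult_mat_vec) (use Hc Rc a that in auto)
  moreover have "orthogonal_mat d (?H * R)"
    by (intro orthogonal_mat_mult orthogonal_reflection_mat v R(1))
  ultimately show ?case using R(2) by (intro exI[of _ "?H * R"]) (auto simp: a'_def)
qed

text \<open>The ideal states will have real amplitudes, so a real orthogonal matrix, read as a
  complex one, serves as the gate.\<close>

lemma equal_gram_imp_unitary_mat:
  fixes a b :: "'x \<Rightarrow> real vec"
  assumes "finite X" and a: "\<And>x. x \<in> X \<Longrightarrow> a x \<in> carrier_vec d" and b: "\<And>x. x \<in> X \<Longrightarrow> b x \<in> carrier_vec d"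
    and "\<And>x y. x \<in> X \<Longrightarrow> y \<in> X \<Longrightarrow> a x \<bullet> a y = b x \<bullet> b y"
  shows "\<exists>U. unitary_mat d U \<and> (\<forall>x\<in>X. U *\<^sub>v map_vec complex_of_real (a x) = map_vec complex_of_real (b x))"
proof -
  obtain R where R: "orthogonal_mat d R" "\<forall>x\<in>X. R *\<^sub>v a x = b x"
    using equal_gram_imp_orthogonal_mat[of X a d b, OF assms] by blast
  have "map_mat complex_of_real R *\<^sub>v map_vec complex_of_real (a x) = map_vec complex_of_real (b x)" if "x \<in> X" for x
    by (subst of_real_hom.mult_mat_vec_hom[of R d d "a x", symmetric])
       (use R that a in \<open>auto simp: orthogonal_mat_def\<close>)
  then show ?thesis using unitary_orthogonal_mat[OF R(1)] by blast
qed

section \<open>Catalytic computation\<close>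

definition phase :: "bool \<Rightarrow> real" where
  "phase b = (if b then - 1 else 1)"

text \<open>\<open>L\<close> is the dimension of an additional register. It holds the start marker
  or the answer, and also numbers the components of the catalyst at a cell.\<close>

locale grid_evaluation =
  fixes n N :: nat and E :: query_circuit and enc :: "nat \<Rightarrow> nat \<Rightarrow> nat \<Rightarrow> nat" and L :: nat
  assumes n: "0 < n" and valid_E: "valid_circuit N E" and valid_enc: "valid_encoding n N E enc"
begin

definition args :: "(nat \<times> nat \<times> nat) set" where
  "args = {..<n} \<times> {..<n} \<times> {..<2}"

definition code :: "nat \<times> nat \<times> nat \<Rightarrow> nat" where
  "code = (\<lambda>(i, j, z). enc i j z)"

definition flip :: "grid \<Rightarrow> nat \<times> nat \<times> nat \<Rightarrow> nat \<times> nat \<times> nat" where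
  "flip f = (\<lambda>(i, j, z). (i, j, (z + of_bool (f i j)) mod 2))"

abbreviation "dE \<equiv> circuit_dim N E"

abbreviation "DL \<equiv> dE * L"

abbreviation "E_gates \<equiv> (first_gate E, later_gates E)"

definition eval_op :: "(nat \<Rightarrow> bool) \<Rightarrow> complex mat" where
  "eval_op x = gates_op N (work_dim E * L) x (pad_gates L E_gates)"

text \<open>Vectors supported on encoded basis states, tensored with the additional register:
  \<open>coherently_evaluates\<close> fixes the behaviour of the circuit on these only.\<close>

definition state :: "(nat \<times> nat \<times> nat \<Rightarrow> nat \<Rightarrow> real) \<Rightarrow> real vec" where
  "state \<alpha> = vec DL (\<lambda>r. if r div L \<in> code ` args then \<alpha> (the_inv_into args code (r div L)) (r mod L) else 0)"

lemma finite_args: "finite args"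
  by (simp add: args_def)

lemma inj_code: "inj_on code args"
  using valid_enc by (simp add: valid_encoding_def code_def args_def)

lemma code_less: "s \<in> args \<Longrightarrow> code s < dE"
  using valid_enc by (auto simp: valid_encoding_def code_def args_def)

lemma flip_in: "s \<in> args \<Longrightarrow> flip f s \<in> args"
  by (auto simp: args_def flip_def)

lemma flip_flip: "s \<in> args \<Longrightarrow> flip f (flip f s) = s"
proof -
  have "((z + b) mod 2 + b) mod 2 = z" if "z < 2" for z b :: nat using that by presburger
  then show "s \<in> args \<Longrightarrow> flip f (flip f s) = s" by (auto simp: args_def flip_def)
qed

lemma state_carrier: "state \<alpha> \<in> carrier_vec DL"
  by (simp add: state_def)

lemma pair_less: "e < dE \<Longrightarrow> k < L \<Longrightarrow> e * L + k < DL"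
proof -
  assume "e < dE" "k < L"
  then have "e * L + k < Suc e * L" by simp
  also have "\<dots> \<le> DL" using \<open>e < dE\<close> by (intro mult_right_mono) auto
  finally show ?thesis .
qed

lemma state_code:
  assumes "s \<in> args" "k < L"
  shows "state \<alpha> $ (code s * L + k) = \<alpha> s k"
  using assms pair_less[OF code_less[OF assms(1)] assms(2)]
  by (simp add: state_def the_inv_into_f_f[OF inj_code])

lemma state_outside:
  assumes "e < dE" "k < L" "e \<notin> code ` args"
  shows "state \<alpha> $ (e * L + k) = 0"
  using assms pair_less[OF assms(1,2)] by (simp add: state_def)

lemma sum_over_code:
  assumes "\<And>e. e < dE \<Longrightarrow> e \<notin> code ` args \<Longrightarrow> g e = 0"
  shows "(\<Sum>e<dE. g e) = (\<Sum>s\<in>args. g (code s))"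
proof -
  have "(\<Sum>e<dE. g e) = (\<Sum>e\<in>code ` args. g e)"
    by (rule sum.mono_neutral_right) (use assms code_less in auto)
  then show ?thesis by (simp add: sum.reindex[OF inj_code])
qed

lemma state_cong:
  assumes "\<And>s k. s \<in> args \<Longrightarrow> k < L \<Longrightarrow> \<alpha> s k = \<beta> s k"
  shows "state \<alpha> = state \<beta>"
proof (rule eq_vecI)
  fix r assume "r < dim_vec (state \<beta>)"
  then have r: "r < DL" by (simp add: state_def)
  then have "r mod L < L" by (cases "L = 0") auto
  then show "state \<alpha> $ r = state \<beta> $ r"
    using assms r by (auto simp: state_def the_inv_into_f_f[OF inj_code])
qed (simp add: state_def)

lemma state_scalar_prod: "state \<alpha> \<bullet> state \<beta> = (\<Sum>s\<in>args. \<Sum>k<L. \<alpha> s k * \<beta> s k)"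
proof -
  have "state \<alpha> \<bullet> state \<beta> = (\<Sum>e<dE. \<Sum>k<L. state \<alpha> $ (e * L + k) * state \<beta> $ (e * L + k))"
    using state_carrier[of \<beta>] sum_div_mod[of "\<lambda>m. state \<alpha> $ m * state \<beta> $ m" dE L]
    by (simp add: scalar_prod_def atLeast0LessThan)
  also have "\<dots> = (\<Sum>s\<in>args. \<Sum>k<L. state \<alpha> $ (code s * L + k) * state \<beta> $ (code s * L + k))"
    by (rule sum_over_code) (simp add: state_outside)
  also have "\<dots> = (\<Sum>s\<in>args. \<Sum>k<L. \<alpha> s k * \<beta> s k)"
    by (intro sum.cong refl) (simp add: state_code)
  finally show ?thesis .
qed

lemma E_gates_unitary: "unitary_gates (N * 2 * work_dim E) E_gates"
  using valid_E by (simp add: valid_circuit_def unitary_gates_def circuit_dim_def)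

lemma DL_eq: "DL = N * 2 * (work_dim E * L)"
  by (simp add: circuit_dim_def)

lemma pad_E_unitary: "unitary_gates DL (pad_gates L E_gates)"
  using unitary_pad_gates[OF E_gates_unitary, of L] by (simp add: circuit_dim_def)

lemma eval_op_eq: "eval_op x = pad_mat L (circuit_op N E x)"
  unfolding eval_op_def using gates_op_pad[OF E_gates_unitary]
  by (simp add: gates_op_def circuit_op_def)

lemma eval_op_carrier: "eval_op x \<in> carrier_mat DL DL"
  unfolding eval_op_def DL_eq
  by (rule gates_op_carrier) (use pad_E_unitary in \<open>simp add: DL_eq\<close>)

lemma sq_norm_eval_op: "v \<in> carrier_vec DL \<Longrightarrow> sq_norm (eval_op x *\<^sub>v v) = sq_norm v"
  unfolding eval_op_def
  by (rule sq_norm_gates_op) (use pad_E_unitary in \<open>simp_all add: DL_eq\<close>)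

text \<open>The evaluation permutes the encoded basis states by \<open>flip f\<close>. As this is an
  involution, the amplitudes are relabelled by the same map and not by a separate inverse.\<close>

lemma eval_op_state:
  assumes eval: "coherently_evaluates n N E enc x f"
  shows "eval_op x *\<^sub>v map_vec complex_of_real (state \<alpha>) = map_vec complex_of_real (state (\<lambda>s. \<alpha> (flip f s)))"
proof (rule eq_vecI)
  let ?v = "map_vec complex_of_real (state \<alpha>)" and ?w = "map_vec complex_of_real (state (\<lambda>s. \<alpha> (flip f s)))"
  let ?C = "circuit_op N E x"
  have C: "?C \<in> carrier_mat dE dE"
    using gates_op_carrier[OF E_gates_unitary] by (simp add: gates_op_def circuit_op_def circuit_dim_def)
  have col: "?C $$ (e, code s) = of_bool (e = code (flip f s))" if "e < dE" "s \<in> args" for e s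
  proof -
    obtain i j z where s: "s = (i, j, z)" by (cases s)
    have "?C $$ (e, code s) = (\<Sum>k<dE. ?C $$ (e, k) * unit_vec dE (code s) $ k)"
    proof -
      have "(\<Sum>k<dE. ?C $$ (e, k) * unit_vec dE (code s) $ k) = (\<Sum>k<dE. if k = code s then ?C $$ (e, k) else 0)"
        by (intro sum.cong refl) (use code_less[OF that(2)] in \<open>auto simp: unit_vec_def\<close>)
      then show ?thesis using code_less[OF that(2)] by simp
    qed
    also have "\<dots> = (?C *\<^sub>v unit_vec dE (code s)) $ e"
      by (rule mult_mat_vec_entry[OF C _ that(1), symmetric]) simp
    also have "\<dots> = unit_vec dE (code (flip f s)) $ e"
      using eval that(2) by (simp add: coherently_evaluates_def s code_def flip_def args_def)
    also have "\<dots> = of_bool (e = code (flip f s))"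
      using that code_less[OF flip_in[OF that(2)], of f] by (simp add: unit_vec_def)
    finally show ?thesis .
  qed
  fix r assume "r < dim_vec ?w"
  then have r: "r < DL" by (simp add: state_def)
  define e k where "e = r div L" and "k = r mod L"
  have k: "k < L" using r by (cases "L = 0") (auto simp: k_def)
  have e: "e < dE" using r by (simp add: e_def less_mult_imp_div_less)
  have rek: "r = e * L + k" by (simp add: e_def k_def)
  have entry: "?v $ (e' * L + k) = complex_of_real (state \<alpha> $ (e' * L + k))" if "e' < dE" for e'
    using pair_less[OF that k] by (simp add: state_def)
  have "(eval_op x *\<^sub>v ?v) $ r = (\<Sum>e'<dE. ?C $$ (e, e') * ?v $ (e' * L + k))"
    unfolding eval_op_eq e_def k_def by (rule pad_mat_mult_vec[OF C _ r]) (simp add: state_def)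
  also have "\<dots> = (\<Sum>e'<dE. ?C $$ (e, e') * complex_of_real (state \<alpha> $ (e' * L + k)))"
    by (intro sum.cong refl) (simp add: entry)
  also have "\<dots> = (\<Sum>s\<in>args. ?C $$ (e, code s) * complex_of_real (state \<alpha> $ (code s * L + k)))"
    by (rule sum_over_code) (simp add: state_outside k)
  also have "\<dots> = (\<Sum>s\<in>args. if e = code (flip f s) then complex_of_real (\<alpha> s k) else 0)"
    by (intro sum.cong refl) (simp add: col e state_code k)
  also have "\<dots> = complex_of_real (state (\<lambda>s. \<alpha> (flip f s)) $ r)"
  proof (cases "e \<in> code ` args")
    case True
    then obtain t where t: "t \<in> args" "e = code t" by auto
    have "e = code (flip f s) \<longleftrightarrow> s = flip f t" if "s \<in> args" for s
      using inj_onD[OF inj_code, of t "flip f s"] t flip_in[OF that] flip_flip that by metis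
    then have "(\<Sum>s\<in>args. if e = code (flip f s) then complex_of_real (\<alpha> s k) else 0) =
        (\<Sum>s\<in>args. if s = flip f t then complex_of_real (\<alpha> s k) else 0)"
      by (intro sum.cong) auto
    also have "\<dots> = complex_of_real (\<alpha> (flip f t) k)" using finite_args flip_in[OF t(1)] by simp
    finally show ?thesis using state_code[OF t(1) k, of "\<lambda>s. \<alpha> (flip f s)"] t rek by simp
  next
    case False
    then have "\<forall>s\<in>args. e \<noteq> code (flip f s)" using flip_in by blast
    then have "(\<Sum>s\<in>args. if e = code (flip f s) then complex_of_real (\<alpha> s k) else 0) = 0"
      by (intro sum.neutral) auto
    then show ?thesis using state_outside[OF e k False] rek by simp
  qed
  also have "\<dots> = ?w $ r" using r by (simp add: state_def)
  finally show "(eval_op x *\<^sub>v ?v) $ r = ?w $ r" .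
qed (use eval_op_carrier[of x] in \<open>simp add: state_def\<close>)

text \<open>The amplitudes \<open>\<eta>\<close> sit on the invariant state \<open>|+>\<close> of the target bit at the cell \<open>(0, 0)\<close>; the
  amplitudes \<open>\<gamma>\<close> sit on \<open>|->\<close>, where the evaluation acts as a phase.\<close>

definition split_state :: "(nat \<Rightarrow> real) \<Rightarrow> (nat \<times> nat \<Rightarrow> nat \<Rightarrow> real) \<Rightarrow> real vec" where
  "split_state \<eta> \<gamma> = state (\<lambda>(i, j, z) k.
     (of_bool ((i, j) = (0, 0)) * \<eta> k + (- 1) ^ z * \<gamma> (i, j) k) / sqrt 2)"

lemma split_state_carrier: "split_state \<eta> \<gamma> \<in> carrier_vec DL"
  by (simp add: split_state_def state_carrier)

lemma eval_op_split_state: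
  assumes "coherently_evaluates n N E enc x f"
  shows "eval_op x *\<^sub>v map_vec complex_of_real (split_state \<eta> \<gamma>) =
    map_vec complex_of_real (split_state \<eta> (\<lambda>p k. phase (f (fst p) (snd p)) * \<gamma> p k))"
proof -
  have "(- 1 :: real) ^ ((z + of_bool b) mod 2) = (- 1) ^ z * phase b" if "z < 2" for z b
    using that by (auto simp: phase_def less_2_cases_iff)
  then show ?thesis
    unfolding split_state_def eval_op_state[OF assms]
    by (intro arg_cong[where f = "map_vec complex_of_real"] state_cong) (auto simp: args_def flip_def)
qed

lemma split_state_scalar_prod:
  "split_state \<eta> \<gamma> \<bullet> split_state \<eta>' \<gamma>' =
     (\<Sum>k<L. \<eta> k * \<eta>' k) + (\<Sum>p\<in>{..<n} \<times> {..<n}. \<Sum>k<L. \<gamma> p k * \<gamma>' p k)"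
proof -
  let ?z = "\<lambda>p :: nat \<times> nat. of_bool (p = (0, 0)) :: real"
  let ?t = "\<lambda>p z k. ((?z p * \<eta> k + (- 1) ^ z * \<gamma> p k) / sqrt 2) * ((?z p * \<eta>' k + (- 1) ^ z * \<gamma>' p k) / sqrt 2)"
  have "split_state \<eta> \<gamma> \<bullet> split_state \<eta>' \<gamma>' = (\<Sum>i<n. \<Sum>j<n. \<Sum>z<2. \<Sum>k<L. ?t (i, j) z k)"
    unfolding split_state_def state_scalar_prod args_def by (simp add: sum.cartesian_product' split_def)
  also have "\<dots> = (\<Sum>p\<in>{..<n} \<times> {..<n}. \<Sum>z<2. \<Sum>k<L. ?t p z k)"
    by (simp add: sum.cartesian_product')
  also have "\<dots> = (\<Sum>p\<in>{..<n} \<times> {..<n}. \<Sum>k<L. \<Sum>z<2. ?t p z k)"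
    by (intro sum.cong refl sum.swap)
  \<comment> \<open>Summing over the target bit cancels the mixed terms, since \<open>|+>\<close>
    and \<open>|->\<close> are orthogonal.\<close>
  also have "\<dots> = (\<Sum>p\<in>{..<n} \<times> {..<n}. \<Sum>k<L. ?z p * (\<eta> k * \<eta>' k) + \<gamma> p k * \<gamma>' p k)"
    by (intro sum.cong refl) (auto simp: numeral_2_eq_2 field_simps)
  also have "\<dots> = (\<Sum>p\<in>{..<n} \<times> {..<n}. ?z p * (\<Sum>k<L. \<eta> k * \<eta>' k)) +
      (\<Sum>p\<in>{..<n} \<times> {..<n}. \<Sum>k<L. \<gamma> p k * \<gamma>' p k)"
    by (simp add: sum.distrib sum_distrib_left)
  also have "(\<Sum>p\<in>{..<n} \<times> {..<n}. ?z p * (\<Sum>k<L. \<eta> k * \<eta>' k)) =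
      (\<Sum>p\<in>{..<n} \<times> {..<n}. if p = (0, 0) then (\<Sum>k<L. \<eta> k * \<eta>' k) else 0)"
    by (intro sum.cong) auto
  also have "\<dots> = (\<Sum>k<L. \<eta> k * \<eta>' k)" using n by simp
  finally show ?thesis .
qed

lemma split_state_add:
  "split_state (\<lambda>k. \<eta> k + \<eta>' k) (\<lambda>p k. \<gamma> p k + \<gamma>' p k) = split_state \<eta> \<gamma> + split_state \<eta>' \<gamma>'"
proof -
  have add: "state \<alpha> + state \<beta> = state (\<lambda>s k. \<alpha> s k + \<beta> s k)" for \<alpha> \<beta>
    by (rule eq_vecI) (auto simp: state_def)
  show ?thesis
    unfolding split_state_def add
    by (intro state_cong) (auto simp: add_divide_distrib[symmetric] algebra_simps)
qed

lemma sq_norm_split_state: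
  "sq_norm (map_vec complex_of_real (split_state (\<lambda>_. 0) \<gamma>)) = (\<Sum>p\<in>{..<n} \<times> {..<n}. \<Sum>k<L. (\<gamma> p k)\<^sup>2)"
proof -
  have "sq_norm (map_vec complex_of_real v) = v \<bullet> v" for v
    by (simp add: sq_norm_def scalar_prod_def atLeast0LessThan power2_eq_square)
  then show ?thesis by (simp add: split_state_scalar_prod power2_eq_square)
qed

lemma split_state_entry_0:
  assumes "r < DL" "\<eta> (r mod L) = 0"
  shows "split_state \<eta> (\<lambda>_ _. 0) $ r = 0"
  using assms by (simp add: split_state_def state_def split_def)

text \<open>The states \<open>\<phi> t f\<close> move the amplitude \<open>1\<close> from the start to the answer \<open>F f\<close> in \<open>T\<close> steps, with the
  help of a catalyst \<open>\<gamma> f / sqrt T\<close> that is returned in each step. The condition on the Gram matrices says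
  that such a step exists. The algorithm starts without the catalyst, which is a small error.\<close>

lemma catalytic_circuit:
  fixes F :: "grid \<Rightarrow> nat" and \<gamma> :: "grid \<Rightarrow> nat \<times> nat \<Rightarrow> nat \<Rightarrow> real" and dec :: "nat \<Rightarrow> 'o"
  assumes X: "finite X" and T: "0 < T" and F: "\<And>f. f \<in> X \<Longrightarrow> Suc (F f) < L" and L: "0 < L"
    and gram: "\<And>f g. f \<in> X \<Longrightarrow> g \<in> X \<Longrightarrow>
      (\<Sum>p\<in>{..<n} \<times> {..<n}. \<Sum>k<L. \<gamma> f p k * \<gamma> g p k) -
      (\<Sum>p\<in>{..<n} \<times> {..<n}. \<Sum>k<L. (phase (f (fst p) (snd p)) * \<gamma> f p k) * (phase (g (fst p) (snd p)) * \<gamma> g p k))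
      = of_bool (F f \<noteq> F g)"
    and cost: "\<And>f. f \<in> X \<Longrightarrow> (\<Sum>p\<in>{..<n} \<times> {..<n}. \<Sum>k<L. (\<gamma> f p k)\<^sup>2) \<le> W"
  shows "\<exists>A :: 'o query_algorithm. valid_circuit N A \<and> num_queries A = T * num_queries E \<and>
    (\<forall>x f correct. f \<in> X \<and> coherently_evaluates n N E enc x f \<and> correct (dec (F f)) \<longrightarrow>
       error_prob N A correct x \<le> 4 * W / real T)"
proof -
  let ?P = "{..<n} \<times> {..<n}"
  let ?c = "map_vec complex_of_real"
  \<comment> \<open>Register value 0 marks the start and \<open>Suc v\<close> the answer
    \<open>v\<close>, so the start state is orthogonal to all answers, including the answer
    0.\<close>
  define \<eta> where "\<eta> t f k = sqrt (real t / real T) * of_bool (k = Suc (F f)) +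
    sqrt (1 - real t / real T) * of_bool (k = 0)" for t f k
  \<comment> \<open>With this scaling one query changes the Gram matrix of the catalyst by
    \<open>1 / T\<close> on pairs with different answers, which is the share of squared amplitude
    moved in one step.\<close>
  define \<chi> where "\<chi> f p k = \<gamma> f p k / sqrt (real T)" for f p k
  define \<chi>' where "\<chi>' f p k = phase (f (fst p) (snd p)) * \<chi> f p k" for f p k
  define \<phi> where "\<phi> t f = split_state (\<eta> t f) (\<chi> f)" for t f
  define \<phi>' where "\<phi>' t f = split_state (\<eta> t f) (\<chi>' f)" for t f
  have carr: "\<phi> t f \<in> carrier_vec DL" "\<phi>' t f \<in> carrier_vec DL" for t f
    by (simp_all add: \<phi>_def \<phi>'_def split_state_carrier)
  have \<eta>\<eta>: "(\<Sum>k<L. \<eta> t f k * \<eta> t g k) = real t / real T * of_bool (F f = F g) + (1 - real t / real T)"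
    if "f \<in> X" "g \<in> X" "t \<le> T" for t f g
  proof -
    have "0 \<le> 1 - real t / real T" using that(3) T by simp
    then have "\<eta> t f k * \<eta> t g k = (if k = Suc (F f) then real t / real T * of_bool (F f = F g) else 0) +
        (if k = 0 then 1 - real t / real T else 0)" for k
      by (auto simp: \<eta>_def)
    then show ?thesis using F[OF that(1)] L by (simp add: sum.distrib)
  qed
  have \<chi>\<chi>: "(\<Sum>p\<in>?P. \<Sum>k<L. \<chi> f p k * \<chi> g p k) - (\<Sum>p\<in>?P. \<Sum>k<L. \<chi>' f p k * \<chi>' g p k) = of_bool (F f \<noteq> F g) / real T"
    if "f \<in> X" "g \<in> X" for f g
    unfolding gram[OF that, symmetric] \<chi>'_def \<chi>_def
    using T by (simp add: diff_divide_distrib sum_divide_distrib mult_ac)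
  have "\<exists>U. unitary_mat DL U \<and> (\<forall>f\<in>X. U *\<^sub>v ?c (\<phi>' t f) = ?c (\<phi> (Suc t) f))" if "t < T" for t
  proof (rule equal_gram_imp_unitary_mat[OF X carr(2) carr(1)])
    fix f g assume fg: "f \<in> X" "g \<in> X"
    have "\<phi>' t f \<bullet> \<phi>' t g = real t / real T * of_bool (F f = F g) + (1 - real t / real T) +
        (\<Sum>p\<in>?P. \<Sum>k<L. \<chi>' f p k * \<chi>' g p k)"
      unfolding \<phi>'_def split_state_scalar_prod using \<eta>\<eta>[OF fg, of t] that by simp
    moreover have "\<phi> (Suc t) f \<bullet> \<phi> (Suc t) g = real (Suc t) / real T * of_bool (F f = F g) + (1 - real (Suc t) / real T) +
        (\<Sum>p\<in>?P. \<Sum>k<L. \<chi> f p k * \<chi> g p k)"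
      unfolding \<phi>_def split_state_scalar_prod using \<eta>\<eta>[OF fg, of "Suc t"] that by simp
    \<comment> \<open>For different answers the overlap of the \<open>\<eta>\<close> parts falls by
      \<open>1 / T\<close> in this step. The catalyst makes up for it: its overlap before the query
      exceeds that after the query by the same amount, and the gate restores the former.\<close>
    ultimately show "\<phi>' t f \<bullet> \<phi>' t g = \<phi> (Suc t) f \<bullet> \<phi> (Suc t) g"
      using \<chi>\<chi>[OF fg] by (cases "F f = F g") (auto simp: add_divide_distrib)
  qed
  then have "\<forall>t\<in>{..<T}. \<exists>U. unitary_mat DL U \<and> (\<forall>f\<in>X. U *\<^sub>v ?c (\<phi>' t f) = ?c (\<phi> (Suc t) f))" by blast
  from bchoice[OF this] obtain U where
    U: "\<forall>t\<in>{..<T}. unitary_mat DL (U t) \<and> (\<forall>f\<in>X. U t *\<^sub>v ?c (\<phi>' t f) = ?c (\<phi> (Suc t) f))" ..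
  define \<xi> where "\<xi> = split_state (\<lambda>k. of_bool (k = 0)) (\<lambda>_ _. 0)"
  have \<xi>: "\<xi> \<in> carrier_vec DL" by (simp add: \<xi>_def split_state_carrier)
  have DL: "0 < DL" using valid_E L by (simp add: valid_circuit_def)
  \<comment> \<open>Preparing the start state is the Gram matrix argument for a single vector of
    norm 1.\<close>
  have "\<exists>U. unitary_mat DL U \<and> (\<forall>u\<in>{()}. U *\<^sub>v ?c (unit_vec DL 0) = ?c \<xi>)"
  proof (rule equal_gram_imp_unitary_mat)
    have "\<xi> \<bullet> \<xi> = 1" unfolding \<xi>_def split_state_scalar_prod using L by simp
    then show "unit_vec DL 0 \<bullet> unit_vec DL 0 = \<xi> \<bullet> \<xi>" using DL by simp
  qed (use \<xi> in auto)
  then obtain V where V: "unitary_mat DL V" "V *\<^sub>v ?c (unit_vec DL 0) = ?c \<xi>" by auto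
  \<comment> \<open>One step is a padded run of \<open>E\<close>, which plays the role of the query,
    followed by the gate that restores the catalyst.\<close>
  define prog where "prog = rec_nat (V, []) (\<lambda>t P. append_gates (append_gates P (pad_gates L E_gates)) (U t, []))"
  have prog_0: "prog 0 = (V, [])" and
    prog_Suc: "prog (Suc t) = append_gates (append_gates (prog t) (pad_gates L E_gates)) (U t, [])" for t
    by (simp_all add: prog_def)
  have unitary_U: "unitary_gates DL (U t, [])" if "t < T" for t using U that by (simp add: unitary_gates_def)
  have unitary_prog: "unitary_gates DL (prog t)" if "t \<le> T" for t
    using that
  proof (induction t)
    case (Suc t)
    then show ?case unfolding prog_Suc by (intro unitary_append_gates pad_E_unitary unitary_U) auto
  qed (simp add: prog_0 unitary_gates_def V(1))
  have length_prog: "length (snd (prog t)) = t * num_queries E" for t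
    by (induction t) (simp_all add: prog_0 prog_Suc length_append_gates pad_gates_def num_queries_def)
  let ?op = "\<lambda>x. gates_op N (work_dim E * L) x"
  let ?e = "unit_vec DL 0 :: complex vec"
  \<comment> \<open>The additional register is the lowest digit of the outcome, and the subtraction
    undoes the \<open>Suc\<close> in \<open>\<eta>\<close>.\<close>
  define A :: "'o query_algorithm" where
    "A = \<lparr>work_dim = work_dim E * L, first_gate = fst (prog T), later_gates = snd (prog T),
          answer = \<lambda>r. dec (r mod L - 1)\<rparr>"
  have dim_A: "circuit_dim N A = DL" by (simp add: A_def circuit_dim_def)
  have op_A: "circuit_op N A x = ?op x (prog T)" for x by (simp add: A_def circuit_op_def gates_op_def)
  have valid: "valid_circuit N A"
    using unitary_prog[of T] DL unfolding valid_circuit_def dim_A by (simp add: A_def unitary_gates_def)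
  have error: "error_prob N A correct x \<le> 4 * W / real T"
    if f: "f \<in> X" and eval: "coherently_evaluates n N E enc x f" and correct: "correct (dec (F f))" for x f correct
  proof -
    define c where "c = ?c (split_state (\<lambda>_. 0) (\<chi> f))"
    have c: "c \<in> carrier_vec DL" using split_state_carrier by (simp add: c_def)
    have op_carrier: "?op x P \<in> carrier_mat DL DL" if "unitary_gates DL P" for P
      using gates_op_carrier[of N "work_dim E * L" P x] that by (simp add: DL_eq)
    have op_append: "?op x (append_gates P R) = ?op x R * ?op x P"
      if "unitary_gates DL P" "unitary_gates DL R" for P R
      using gates_op_append[of N "work_dim E * L" P R x] that by (simp add: DL_eq)
    have e: "?c (unit_vec DL 0) = ?e" by (rule eq_vecI) (auto simp: unit_vec_def)
    \<comment> \<open>\<open>\<delta>\<close> starts as the omitted catalyst. It may leave the span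
      of the encoded states, where nothing is known about the evaluation except that it is linear
      and isometric; hence its norm, but not its direction, is tracked, and the error does not grow
      with \<open>t\<close>.\<close>
    have "\<exists>\<delta>\<in>carrier_vec DL. ?op x (prog t) *\<^sub>v ?e = ?c (\<phi> t f) - \<delta> \<and> sq_norm \<delta> = sq_norm c" if "t \<le> T" for t
      using that
    proof (induction t)
      case 0
      have "\<phi> 0 f = split_state (\<lambda>k. of_bool (k = 0) + 0) (\<lambda>p k. 0 + \<chi> f p k)"
        unfolding \<phi>_def by (rule arg_cong2[where f = split_state]) (auto simp: \<eta>_def)
      also have "\<dots> = \<xi> + split_state (\<lambda>_. 0) (\<chi> f)" unfolding split_state_add \<xi>_def ..
      finally have "?c (\<phi> 0 f) - c = ?c \<xi>"
        using \<xi> split_state_carrier[of "\<lambda>_. 0" "\<chi> f"] by (intro eq_vecI) (auto simp: c_def)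
      then show ?case using V(2) c by (intro bexI[of _ c]) (auto simp: prog_0 gates_op_def e)
    next
      case (Suc t)
      then obtain \<delta> where \<delta>: "\<delta> \<in> carrier_vec DL" "?op x (prog t) *\<^sub>v ?e = ?c (\<phi> t f) - \<delta>" "sq_norm \<delta> = sq_norm c"
        by auto
      have Ut: "unitary_mat DL (U t)" "U t *\<^sub>v ?c (\<phi>' t f) = ?c (\<phi> (Suc t) f)" and Uc: "U t \<in> carrier_mat DL DL"
        using U Suc.prems f by (auto simp: unitary_mat_def)
      note gs = unitary_prog[of t] pad_E_unitary unitary_U[of t]
      have "?op x (prog (Suc t)) = U t * (eval_op x * ?op x (prog t))"
        unfolding prog_Suc eval_op_def using Suc.prems gs
        by (subst op_append) (auto intro: unitary_append_gates simp: op_append gates_op_def[of _ _ _ "(U t, [])"])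
      then have "?op x (prog (Suc t)) *\<^sub>v ?e = U t *\<^sub>v (eval_op x *\<^sub>v (?op x (prog t) *\<^sub>v ?e))"
        using Uc eval_op_carrier[of x] op_carrier[OF gs(1)] Suc.prems
        by (simp add: assoc_mult_mat_vec[of _ DL DL _ DL])
      also have "\<dots> = U t *\<^sub>v (?c (\<phi>' t f) - eval_op x *\<^sub>v \<delta>)"
        unfolding \<delta>(2) using mult_minus_distrib_mat_vec[OF eval_op_carrier[of x], of "?c (\<phi> t f)" \<delta>]
          carr \<delta>(1) eval_op_split_state[OF eval, of "\<eta> t f" "\<chi> f"]
        by (simp add: \<phi>_def \<phi>'_def \<chi>'_def[abs_def])
      also have "\<dots> = ?c (\<phi> (Suc t) f) - U t *\<^sub>v (eval_op x *\<^sub>v \<delta>)"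
        using mult_minus_distrib_mat_vec[OF Uc, of "?c (\<phi>' t f)" "eval_op x *\<^sub>v \<delta>"] Ut(2)
          carr eval_op_carrier[of x] \<delta>(1) by simp
      finally have "?op x (prog (Suc t)) *\<^sub>v ?e = ?c (\<phi> (Suc t) f) - U t *\<^sub>v (eval_op x *\<^sub>v \<delta>)" .
      moreover have E\<delta>: "eval_op x *\<^sub>v \<delta> \<in> carrier_vec DL" using eval_op_carrier[of x] \<delta>(1) by simp
      moreover have "U t *\<^sub>v (eval_op x *\<^sub>v \<delta>) \<in> carrier_vec DL" using Uc E\<delta> by simp
      ultimately show ?case
        using sq_norm_unitary[OF Ut(1) E\<delta>] sq_norm_eval_op[OF \<delta>(1)] \<delta>(3) by auto
    qed
    from this[of T] obtain \<delta> where \<delta>: "\<delta> \<in> carrier_vec DL" "?op x (prog T) *\<^sub>v ?e = ?c (\<phi> T f) - \<delta>"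
      "sq_norm \<delta> = sq_norm c" by auto
    define \<tau> where "\<tau> = split_state (\<lambda>k. of_bool (k = Suc (F f))) (\<lambda>_ _. 0)"
    have \<tau>: "\<tau> \<in> carrier_vec DL" by (simp add: \<tau>_def split_state_carrier)
    have "\<phi> T f = split_state (\<lambda>k. of_bool (k = Suc (F f)) + 0) (\<lambda>p k. 0 + \<chi> f p k)"
      unfolding \<phi>_def by (rule arg_cong2[where f = split_state]) (use T in \<open>auto simp: \<eta>_def\<close>)
    also have "\<dots> = \<tau> + split_state (\<lambda>_. 0) (\<chi> f)" unfolding split_state_add \<tau>_def ..
    finally have \<phi>T: "?c (\<phi> T f) = ?c \<tau> + c"
      using \<tau> split_state_carrier[of "\<lambda>_. 0" "\<chi> f"] by (intro eq_vecI) (auto simp: c_def)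
    \<comment> \<open>The final state is \<open>\<tau> + c - \<delta>\<close>, and
      \<open>\<tau>\<close> is supported on outcomes that decode to the correct answer. As
      \<open>c\<close> and \<open>\<delta>\<close> have the same norm, the error is at most four
      times the squared norm of \<open>c\<close>.\<close>
    have wrong: "(circuit_op N A x *\<^sub>v unit_vec (circuit_dim N A) 0) $ r = (c - \<delta>) $ r"
      if "r < DL" "\<not> correct (answer A r)" for r
    proof -
      have "r mod L \<noteq> Suc (F f)" using that(2) correct by (auto simp: A_def)
      then have "\<tau> $ r = 0" unfolding \<tau>_def using that(1) by (intro split_state_entry_0) auto
      then show ?thesis unfolding op_A dim_A \<delta>(2) \<phi>T using that(1) \<tau> c \<delta>(1) by simp
    qed
    have "error_prob N A correct x = (\<Sum>r | r < DL \<and> \<not> correct (answer A r). (cmod ((c - \<delta>) $ r))\<^sup>2)"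
      unfolding error_prob_def using wrong by (intro sum.cong) (auto simp: dim_A)
    also have "\<dots> \<le> sq_norm (c - \<delta>)"
      unfolding sq_norm_def by (rule sum_mono2) (use c \<delta>(1) in auto)
    also have "\<dots> \<le> 4 * sq_norm c" using sq_norm_diff_le[OF c \<delta>(1)] \<delta>(3) by simp
    also have "sq_norm c = (\<Sum>p\<in>?P. \<Sum>k<L. (\<gamma> f p k)\<^sup>2) / real T"
      unfolding c_def sq_norm_split_state using T by (simp add: \<chi>_def power_divide sum_divide_distrib)
    also have "4 * \<dots> \<le> 4 * W / real T" using cost[OF f] T by (simp add: divide_right_mono)
    finally show ?thesis .
  qed
  have "num_queries A = T * num_queries E" by (simp add: A_def num_queries_def length_prog[unfolded num_queries_def])
  then show ?thesis using valid error by blast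
qed

end

text \<open>Multiplying the negative part of each kernel by the phase turns the signed kernel into a
  difference of two Gram matrices: the one before and the one after a query.\<close>

lemma cell_kernels_catalyst:
  fixes F :: "'x \<Rightarrow> 'f"
  assumes P: "finite P" and K: "cell_kernels X P rd K W"
    and total: "\<And>x y. x \<in> X \<Longrightarrow> y \<in> X \<Longrightarrow> (\<Sum>p\<in>P. K p x y) = of_bool (F x \<noteq> F y)"
  shows "\<exists>(m :: nat) \<gamma>. \<forall>L\<ge>m.
    (\<forall>x\<in>X. \<forall>y\<in>X. (\<Sum>p\<in>P. \<Sum>k<L. \<gamma> x p k * \<gamma> y p k) -
       (\<Sum>p\<in>P. \<Sum>k<L. (phase (rd x p) * \<gamma> x p k) * (phase (rd y p) * \<gamma> y p k)) = of_bool (F x \<noteq> F y)) \<and>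
    (\<forall>x\<in>X. (\<Sum>p\<in>P. \<Sum>k<L. (\<gamma> x p k)\<^sup>2) \<le> W / 2)"
proof -
  have agree: "K p x y = 0" if "p \<in> P" "x \<in> X" "y \<in> X" "rd x p = rd y p" for p x y
    using K that unfolding cell_kernels_def by blast
  obtain a where sk: "\<forall>p\<in>P. signed_kernel X (K p) (a p)" and a: "\<forall>x\<in>X. (\<Sum>p\<in>P. a p x) \<le> W"
    using K unfolding cell_kernels_def by blast
  from sk have "\<forall>p\<in>P. \<exists>(m :: nat) s v.
     (\<forall>l<m. s l = 1 \<or> s l = - 1) \<and>
     (\<forall>x\<in>X. \<forall>y\<in>X. K p x y = (\<Sum>l<m. s l * (v l x * v l y))) \<and>
     (\<forall>x\<in>X. (\<Sum>l<m. (v l x)\<^sup>2) \<le> a p x)"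
    unfolding signed_kernel_def .
  from bchoice[OF this] obtain m :: "_ \<Rightarrow> nat" where "\<forall>p\<in>P. \<exists>s v.
     (\<forall>l<m p. s l = 1 \<or> s l = - 1) \<and>
     (\<forall>x\<in>X. \<forall>y\<in>X. K p x y = (\<Sum>l<m p. s l * (v l x * v l y))) \<and>
     (\<forall>x\<in>X. (\<Sum>l<m p. (v l x)\<^sup>2) \<le> a p x)" ..
  from bchoice[OF this] obtain s where "\<forall>p\<in>P. \<exists>v.
     (\<forall>l<m p. s p l = 1 \<or> s p l = - 1) \<and>
     (\<forall>x\<in>X. \<forall>y\<in>X. K p x y = (\<Sum>l<m p. s p l * (v l x * v l y))) \<and>
     (\<forall>x\<in>X. (\<Sum>l<m p. (v l x)\<^sup>2) \<le> a p x)" ..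
  from bchoice[OF this] obtain v where *: "\<forall>p\<in>P.
     (\<forall>l<m p. s p l = 1 \<or> s p l = - 1) \<and>
     (\<forall>x\<in>X. \<forall>y\<in>X. K p x y = (\<Sum>l<m p. s p l * (v p l x * v p l y))) \<and>
     (\<forall>x\<in>X. (\<Sum>l<m p. (v p l x)\<^sup>2) \<le> a p x)" ..
  \<comment> \<open>Where the two inputs differ, their phases have product -1, so subtracting the
    term after the query doubles it. The factor \<open>1 / sqrt 2\<close> compensates for this and
    halves the cost. Components from \<open>m p\<close> on are 0, so one register size fits all
    cells.\<close>
  define \<gamma> where "\<gamma> x p k =
    (if k < m p then v p k x * (if s p k = 1 then 1 else phase (rd x p)) / sqrt 2 else 0)" for x p k
  have restrict: "(\<Sum>k<L. t k) = (\<Sum>k<m p. t k)"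
    if "sum m P \<le> L" "p \<in> P" "\<And>k. m p \<le> k \<Longrightarrow> t k = 0" for L p and t :: "nat \<Rightarrow> real"
  proof (rule sum.mono_neutral_right)
    show "{..<m p} \<subseteq> {..<L}" using member_le_sum[OF that(2) _ P, of m] that(1) by auto
  qed (use that(3) in auto)
  show ?thesis
  proof (intro exI[of _ "sum m P"] exI[of _ \<gamma>] allI impI conjI ballI)
    fix L x y assume L: "sum m P \<le> L" and xy: "x \<in> X" "y \<in> X"
    have "(\<Sum>k<L. \<gamma> x p k * \<gamma> y p k) - (\<Sum>k<L. (phase (rd x p) * \<gamma> x p k) * (phase (rd y p) * \<gamma> y p k)) = K p x y"
      if p: "p \<in> P" for p
    proof -
      have "(\<Sum>k<L. \<gamma> x p k * \<gamma> y p k) - (\<Sum>k<L. (phase (rd x p) * \<gamma> x p k) * (phase (rd y p) * \<gamma> y p k)) =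
          (\<Sum>k<m p. \<gamma> x p k * \<gamma> y p k - (phase (rd x p) * \<gamma> x p k) * (phase (rd y p) * \<gamma> y p k))"
        unfolding sum_subtractf[symmetric] by (rule restrict[OF L p]) (simp add: \<gamma>_def)
      also have "\<dots> = (\<Sum>k<m p. of_bool (rd x p \<noteq> rd y p) * (s p k * (v p k x * v p k y)))"
      proof (intro sum.cong refl)
        fix k assume "k \<in> {..<m p}"
        then have k: "k < m p" "s p k = 1 \<or> s p k = - 1" using * p by auto
        show "\<gamma> x p k * \<gamma> y p k - (phase (rd x p) * \<gamma> x p k) * (phase (rd y p) * \<gamma> y p k) =
            of_bool (rd x p \<noteq> rd y p) * (s p k * (v p k x * v p k y))"
          using k by (auto simp: \<gamma>_def phase_def)
      qed
      also have "\<dots> = of_bool (rd x p \<noteq> rd y p) * K p x y"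
        using * p xy by (simp add: sum_distrib_left)
      also have "\<dots> = K p x y" using agree[OF p xy] by auto
      finally show ?thesis .
    qed
    then show "(\<Sum>p\<in>P. \<Sum>k<L. \<gamma> x p k * \<gamma> y p k) -
       (\<Sum>p\<in>P. \<Sum>k<L. (phase (rd x p) * \<gamma> x p k) * (phase (rd y p) * \<gamma> y p k)) = of_bool (F x \<noteq> F y)"
      unfolding total[OF xy, symmetric] sum_subtractf[symmetric] by (intro sum.cong) auto
  next
    fix L x assume L: "sum m P \<le> L" and x: "x \<in> X"
    have "(\<Sum>k<L. (\<gamma> x p k)\<^sup>2) \<le> a p x / 2" if p: "p \<in> P" for p
    proof -
      have "(\<Sum>k<L. (\<gamma> x p k)\<^sup>2) = (\<Sum>k<m p. (\<gamma> x p k)\<^sup>2)"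
        by (rule restrict[OF L p]) (simp add: \<gamma>_def)
      also have "\<dots> = (\<Sum>k<m p. (v p k x)\<^sup>2) / 2"
        unfolding sum_divide_distrib by (intro sum.cong refl) (auto simp: \<gamma>_def phase_def power_divide)
      finally show ?thesis using * p x by auto
    qed
    then have "(\<Sum>p\<in>P. \<Sum>k<L. (\<gamma> x p k)\<^sup>2) \<le> (\<Sum>p\<in>P. a p x / 2)" by (rule sum_mono)
    also have "\<dots> \<le> W / 2" using a x by (simp add: sum_divide_distrib[symmetric])
    finally show "(\<Sum>p\<in>P. \<Sum>k<L. (\<gamma> x p k)\<^sup>2) \<le> W / 2" .
  qed
qed

section \<open>Restriction to finitely many inputs and the resulting algorithm\<close>

definition on_grid :: "nat \<Rightarrow> grid \<Rightarrow> grid" where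
  "on_grid n f = (\<lambda>i j. i < n \<and> j < n \<and> f i j)"

text \<open>The vectors are matched one after the other in
  \<open>equal_gram_imp_orthogonal_mat\<close>, which requires a finite set of inputs. Clearing all
  values outside the grid achieves this without changing the problem.\<close>

lemma finite_grids: "finite (range (on_grid n))"
proof (rule finite_subset)
  show "range (on_grid n) \<subseteq> (\<lambda>S i j. (i, j) \<in> S) ` Pow ({..<n} \<times> {..<n})"
  proof
    fix g assume "g \<in> range (on_grid n)"
    then have "g = (\<lambda>i j. (i, j) \<in> {(i, j). g i j})" "{(i, j). g i j} \<subseteq> {..<n} \<times> {..<n}"
      by (auto simp: on_grid_def)
    then show "g \<in> (\<lambda>S i j. (i, j) \<in> S) ` Pow ({..<n} \<times> {..<n})" by blast
  qed
qed simp

lemma coherently_evaluates_on_grid: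
  "coherently_evaluates n N E enc x (on_grid n f) \<longleftrightarrow> coherently_evaluates n N E enc x f"
  by (simp add: coherently_evaluates_def on_grid_def)

lemma empty_rect_on_grid: "empty_rect n (on_grid n f) = empty_rect n f"
proof
  fix r show "empty_rect n (on_grid n f) r = empty_rect n f r"
    by (cases r) (auto simp: on_grid_def)
qed

text \<open>Emptiness supplies the bounds on the corners. With these, a neighbouring line is
  inspected only if it lies on the grid, where both functions agree.\<close>

lemma enclosed_rect_on_grid:
  assumes "empty_rect n f r"
  shows "enclosed_rect n (on_grid n f) r \<longleftrightarrow> enclosed_rect n f r"
proof (cases r)
  case (fields x1 y1 x2 y2)
  then have "x1 \<le> x2" "x2 < n" "y1 \<le> y2" "y2 < n" using assms by auto
  then show ?thesis unfolding fields by (auto simp: on_grid_def)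
qed

lemma empty_areas_on_grid: "empty_areas_are_rectangles n (on_grid n f) \<longleftrightarrow> empty_areas_are_rectangles n f"
proof -
  have "(empty_rect n f r \<and> in_rect i j r \<and> enclosed_rect n (on_grid n f) r) \<longleftrightarrow>
      (empty_rect n f r \<and> in_rect i j r \<and> enclosed_rect n f r)" for r i j
    using enclosed_rect_on_grid by blast
  then show ?thesis
    unfolding empty_areas_are_rectangles_def empty_rect_on_grid by (simp add: on_grid_def)
qed

lemma lrec2_correct_on_grid: "lrec2_correct n h w (on_grid n f) = lrec2_correct n h w f"
proof
  fix r show "lrec2_correct n h w (on_grid n f) r = lrec2_correct n h w f r"
    by (cases r) (simp_all add: admissible_rect_def empty_rect_on_grid)
qed

lemma lrec2_circuit:
  assumes hw: "1 \<le> h" "h \<le> n" "1 \<le> w" and E: "valid_circuit N E" "valid_encoding n N E enc"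
  shows "\<exists>A :: rect option query_algorithm. valid_circuit N A \<and>
    real (num_queries A) \<le> 1281 * (real n powr 1.5 * real (num_queries E)) \<and>
    (\<forall>x f. coherently_evaluates n N E enc x f \<and> empty_areas_are_rectangles n f \<longrightarrow>
       error_prob N A (lrec2_correct n h w f) x \<le> 0.1)"
proof -
  have n: "1 \<le> n" using hw by simp
  define R where "R = real n * sqrt (real n)"
  have R1: "1 \<le> R" unfolding R_def using n mult_mono[of 1 "real n" 1 "sqrt (real n)"] by simp
  have powr: "real n powr 1.5 = R"
    using n powr_add[of "real n" 1 "1 / 2"] by (simp add: R_def powr_half_sqrt)
  define X where "X = range (on_grid n)"
  define F where "F = best_key n h w"
  have X: "finite X" unfolding X_def by (rule finite_grids)
  obtain K where K: "cell_kernels X ({..<n} \<times> {..<n}) read_cell K (64 * R)"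
    "\<And>f g. f \<in> X \<Longrightarrow> g \<in> X \<Longrightarrow> (\<Sum>p\<in>{..<n} \<times> {..<n}. K p f g) = of_bool (F f \<noteq> F g)"
    using cell_kernels_best_key[OF X n] unfolding R_def F_def by blast
  have "finite ({..<n} \<times> {..<n})" by simp
  from cell_kernels_catalyst[OF this K] obtain m :: nat and \<gamma> where \<gamma>: "\<forall>L\<ge>m.
    (\<forall>f\<in>X. \<forall>g\<in>X. (\<Sum>p\<in>{..<n} \<times> {..<n}. \<Sum>k<L. \<gamma> f p k * \<gamma> g p k) -
       (\<Sum>p\<in>{..<n} \<times> {..<n}. \<Sum>k<L. (phase (read_cell f p) * \<gamma> f p k) * (phase (read_cell g p) * \<gamma> g p k)) =
       of_bool (F f \<noteq> F g)) \<and>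
    (\<forall>f\<in>X. (\<Sum>p\<in>{..<n} \<times> {..<n}. \<Sum>k<L. (\<gamma> f p k)\<^sup>2) \<le> 64 * R / 2)"
    by blast
  \<comment> \<open>Large enough for the catalyst and for every register value
    \<open>Suc (F f)\<close>; the sum over the finite set \<open>X\<close> bounds each
    \<open>F f\<close>.\<close>
  define L where "L = m + 2 + sum F X"
  \<comment> \<open>The squared norm of the catalyst is at most \<open>32 * R\<close>, so the error
    is at most \<open>128 * R / T\<close>, which is 0.1 for \<open>T = 1280 * R\<close>. Rounding up
    adds at most \<open>1 \<le> R\<close>, whence the factor 1281.\<close>
  define T where "T = nat \<lceil>1280 * R\<rceil>"
  have "0 < 1280 * R" using R1 by simp
  then have T: "0 < T" "1280 * R \<le> real T" "real T \<le> 1280 * R + 1"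
    unfolding T_def by linarith+
  interpret grid_evaluation n N E enc L
    using n E by unfold_locales auto
  have "\<exists>A :: rect option query_algorithm. valid_circuit N A \<and> num_queries A = T * num_queries E \<and>
    (\<forall>x f correct. f \<in> X \<and> coherently_evaluates n N E enc x f \<and> correct (key_rect n (F f)) \<longrightarrow>
       error_prob N A correct x \<le> 4 * (64 * R / 2) / real T)"
  proof (rule catalytic_circuit[OF X T(1), where \<gamma> = \<gamma>])
    show "Suc (F f) < L" if "f \<in> X" for f
      using member_le_sum[OF that _ X, of F] by (simp add: L_def)
    have L: "m \<le> L" by (simp add: L_def)
    show "(\<Sum>p\<in>{..<n} \<times> {..<n}. \<Sum>k<L. (\<gamma> f p k)\<^sup>2) \<le> 64 * R / 2" if "f \<in> X" for f
      using \<gamma>[rule_format, OF L] that by blast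
    show "(\<Sum>p\<in>{..<n} \<times> {..<n}. \<Sum>k<L. \<gamma> f p k * \<gamma> g p k) -
      (\<Sum>p\<in>{..<n} \<times> {..<n}. \<Sum>k<L. phase (f (fst p) (snd p)) * \<gamma> f p k * (phase (g (fst p) (snd p)) * \<gamma> g p k)) =
      of_bool (F f \<noteq> F g)" if "f \<in> X" "g \<in> X" for f g
      using \<gamma>[rule_format, OF L] that unfolding read_cell_def by blast
  qed (simp add: L_def)
  then obtain A :: "rect option query_algorithm" where A: "valid_circuit N A" "num_queries A = T * num_queries E"
    "\<And>x f correct. f \<in> X \<Longrightarrow> coherently_evaluates n N E enc x f \<Longrightarrow> correct (key_rect n (F f)) \<Longrightarrow>
       error_prob N A correct x \<le> 4 * (64 * R / 2) / real T"
    by blast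
  have "error_prob N A (lrec2_correct n h w f) x \<le> 0.1"
    if "coherently_evaluates n N E enc x f" "empty_areas_are_rectangles n f" for x f
  proof -
    have "lrec2_correct n h w f (key_rect n (F (on_grid n f)))"
      using best_key_correct[of n "on_grid n f" h w] that(2) hw
      by (simp add: F_def empty_areas_on_grid lrec2_correct_on_grid)
    then have "error_prob N A (lrec2_correct n h w f) x \<le> 4 * (64 * R / 2) / real T"
      using that(1) by (intro A(3)[of "on_grid n f"]) (simp_all add: X_def coherently_evaluates_on_grid)
    also have "\<dots> \<le> 0.1" using T by (simp add: field_simps)
    finally show ?thesis .
  qed
  moreover have "real (num_queries A) \<le> 1281 * (real n powr 1.5 * real (num_queries E))"
  proof -
    have "real T \<le> 1281 * R" using T(3) R1 by simp
    from mult_right_mono[OF this, of "real (num_queries E)"] show ?thesis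
      unfolding A(2) powr by (simp add: mult.assoc)
  qed
  ultimately show ?thesis using A(1) by blast
qed

theorem theorem8:
  shows "\<exists>(C :: real) (alg :: nat \<Rightarrow> nat \<Rightarrow> nat \<Rightarrow> nat \<Rightarrow> query_circuit \<Rightarrow>
             (nat \<Rightarrow> nat \<Rightarrow> nat \<Rightarrow> nat) \<Rightarrow> rect option query_algorithm).
    C > 0 \<and>
    (\<forall>n h w N E enc.
       1 \<le> h \<and> h \<le> n \<and> 1 \<le> w \<and> w \<le> n \<and> valid_circuit N E \<and> valid_encoding n N E enc \<longrightarrow>
       (let A = alg n h w N E enc in
          valid_circuit N A \<and>
          real (num_queries A) \<le> C * (real n powr 1.5 * real (num_queries E)) \<and>
          (\<forall>x f. coherently_evaluates n N E enc x f \<and> empty_areas_are_rectangles n f \<longrightarrow>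
             error_prob N A (lrec2_correct n h w f) x \<le> 0.1)))"
proof -
  \<comment> \<open>The quantifier over inputs is inside \<open>good\<close>, so the algorithm
    chosen depends on the parameters, on \<open>E\<close> and on \<open>enc\<close>, but neither on
    \<open>x\<close> nor on \<open>f\<close>.\<close>
  define good where "good n h w N E enc (A :: rect option query_algorithm) \<longleftrightarrow> valid_circuit N A \<and>
    real (num_queries A) \<le> 1281 * (real n powr 1.5 * real (num_queries E)) \<and>
    (\<forall>x f. coherently_evaluates n N E enc x f \<and> empty_areas_are_rectangles n f \<longrightarrow>
       error_prob N A (lrec2_correct n h w f) x \<le> 0.1)" for n h w N E enc A
  have "good n h w N E enc (SOME A. good n h w N E enc A)"
    if "1 \<le> h \<and> h \<le> n \<and> 1 \<le> w \<and> w \<le> n \<and> valid_circuit N E \<and> valid_encoding n N E enc" for n h w N E enc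
    by (rule someI_ex, unfold good_def, rule lrec2_circuit) (use that in auto)
  then show ?thesis
    by (intro exI[of _ 1281] exI[of _ "\<lambda>n h w N E enc. SOME A. good n h w N E enc A"])
       (simp add: good_def Let_def)
qed

end
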